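(* Let $A=\{a^1,\dots,a^n\}$ be a te-brick and $C=\operatorname{cone}(A)$. 1. If $A$ is a tu-set, then $\mathcal H(C)=A$. 2. If $A$ is a te-lace, then $\mathcal H(C)=A\cup\{\tfrac12\sum_j a^j\}$. 3. If $A$ is a thin te-interlace, then $\mathcal H(C)=A\cup\{\tfrac12(a^i+a^j)\}_{1\le i<j\le n}$. 4. If $A$ is a thick te-interlace, then in every nonzero column of the matrix $A$ the number of entries equal to $1$ and the number of entries equal to $-1$ have the same parity, this parity $p\in\{0,1\}$ is the same for all nonzero columns, and: (a) if $n\equiv 2p\pmod 4$, then $\mathcal H(C)=A\cup\{\tfrac12(a^i+a^j)\}_{1\le i<j\le n}\cup\{\tfrac14\sum_j a^j\}$; (b) otherwise, $\mathcal H(C)=A\cup\{\tfrac12(a^i+a^j)\}_{1\le i<j\le n}\cup\{\tfrac34a^i+\tfrac14\sum_{j\ne i}a^j\}_{i=1,\dots,n}$.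
   Context: $\operatorname{cone}(A)$ is the set of nonnegative combinations of $A$. For a pointed rational cone $C$, the Hilbert basis $\mathcal H(C)$ is the unique inclusion-minimal finite set of integer vectors of $C$ such that every integer point of $C$ is a nonnegative integer combination of them. A linearly independent set of $\{0,\pm1\}$-vectors (identified with the matrix of its rows) is a tu-set if its matrix is totally unimodular (all square subdeterminants in $\{0,\pm1\}$), a te-set if its matrix is totally equimodular (every linearly independent set of rows has full row rank with all nonzero maximal minors of equal absolute value, the equideterminant), a te-lace if it is a te-set, not a tu-set, with all proper subsets tu-sets, and a te-interlace if it is a te-set, not a tu-set, with every pair of its vectors a te-lace. A te-interlace of size $\ell$ is thin if its equideterminant is $2^{\ell-1}$ and thick if it is $2^\ell$. A te-brick is a tu-set, a te-lace, a thin te-interlace or a thick te-interlace. *)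

theory Defs
  imports "Jordan_Normal_Form.Determinant" "Jordan_Normal_Form.DL_Submatrix"
begin

text \<open>Vectors live in R^d (JNF vectors of dimension d). A finite family of vectors
  a^0, ..., a^(n-1) is given as the rows of a real matrix M with n rows and d columns;
  a subset of the family corresponds to a set R of row indices.\<close>

definition pm_mat :: "real mat \<Rightarrow> bool" where
  "pm_mat M \<longleftrightarrow> (\<forall>i<dim_row M. \<forall>j<dim_col M. M $$ (i,j) \<in> {-1, 0, 1})"

definition rows_indep :: "real mat \<Rightarrow> nat set \<Rightarrow> bool" where
  "rows_indep M R \<longleftrightarrow> (\<forall>c :: nat \<Rightarrow> real.
      (\<forall>j<dim_col M. (\<Sum>i\<in>R. c i * M $$ (i,j)) = 0) \<longrightarrow> (\<forall>i\<in>R. c i = 0))"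

definition tu_mat :: "real mat \<Rightarrow> bool" where
  "tu_mat M \<longleftrightarrow> (\<forall>R J. R \<subseteq> {..<dim_row M} \<longrightarrow> J \<subseteq> {..<dim_col M} \<longrightarrow> card R = card J
      \<longrightarrow> det (submatrix M R J) \<in> {-1, 0, 1})"

definition te_mat :: "real mat \<Rightarrow> bool" where
  "te_mat M \<longleftrightarrow> (\<forall>R J J'. R \<subseteq> {..<dim_row M} \<longrightarrow> rows_indep M R \<longrightarrow>
      J \<subseteq> {..<dim_col M} \<longrightarrow> J' \<subseteq> {..<dim_col M} \<longrightarrow> card J = card R \<longrightarrow> card J' = card R \<longrightarrow>
      det (submatrix M R J) \<noteq> 0 \<longrightarrow> det (submatrix M R J') \<noteq> 0 \<longrightarrow>
      \<bar>det (submatrix M R J)\<bar> = \<bar>det (submatrix M R J')\<bar>)"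

definition rowsub :: "real mat \<Rightarrow> nat set \<Rightarrow> real mat" where
  "rowsub M R = submatrix M R {..<dim_col M}"

definition tu_set :: "real mat \<Rightarrow> nat set \<Rightarrow> bool" where
  "tu_set M R \<longleftrightarrow> R \<subseteq> {..<dim_row M} \<and> pm_mat M \<and> rows_indep M R \<and> tu_mat (rowsub M R)"

definition te_set :: "real mat \<Rightarrow> nat set \<Rightarrow> bool" where
  "te_set M R \<longleftrightarrow> R \<subseteq> {..<dim_row M} \<and> pm_mat M \<and> rows_indep M R \<and> te_mat (rowsub M R)"

definition te_lace :: "real mat \<Rightarrow> nat set \<Rightarrow> bool" where
  "te_lace M R \<longleftrightarrow> te_set M R \<and> \<not> tu_set M R \<and> (\<forall>R'. R' \<subset> R \<longrightarrow> tu_set M R')"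

definition te_interlace :: "real mat \<Rightarrow> nat set \<Rightarrow> bool" where
  "te_interlace M R \<longleftrightarrow> te_set M R \<and> \<not> tu_set M R \<and>
      (\<forall>i\<in>R. \<forall>j\<in>R. i \<noteq> j \<longrightarrow> te_lace M {i, j})"

definition equidet :: "real mat \<Rightarrow> nat set \<Rightarrow> real \<Rightarrow> bool" where
  "equidet M R k \<longleftrightarrow> (\<exists>J. J \<subseteq> {..<dim_col M} \<and> card J = card R \<and>
      det (submatrix M R J) \<noteq> 0 \<and> \<bar>det (submatrix M R J)\<bar> = k)"

definition thin_te_interlace :: "real mat \<Rightarrow> nat set \<Rightarrow> bool" where
  "thin_te_interlace M R \<longleftrightarrow> te_interlace M R \<and> equidet M R (2 ^ (card R - 1))"

definition thick_te_interlace :: "real mat \<Rightarrow> nat set \<Rightarrow> bool" where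
  "thick_te_interlace M R \<longleftrightarrow> te_interlace M R \<and> equidet M R (2 ^ card R)"

definition te_brick :: "real mat \<Rightarrow> nat set \<Rightarrow> bool" where
  "te_brick M R \<longleftrightarrow> tu_set M R \<or> te_lace M R \<or> thin_te_interlace M R \<or> thick_te_interlace M R"

definition cone_rows :: "real mat \<Rightarrow> real vec set" where
  "cone_rows M = {v. \<exists>c :: nat \<Rightarrow> real. (\<forall>i<dim_row M. c i \<ge> 0) \<and>
      v = vec (dim_col M) (\<lambda>j. \<Sum>i<dim_row M. c i * M $$ (i,j))}"

definition int_vec :: "nat \<Rightarrow> real vec \<Rightarrow> bool" where
  "int_vec d v \<longleftrightarrow> v \<in> carrier_vec d \<and> (\<forall>j<d. v $ j \<in> \<int>)"

definition hb_generating :: "nat \<Rightarrow> real vec set \<Rightarrow> real vec set \<Rightarrow> bool" where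
  "hb_generating d C H \<longleftrightarrow> finite H \<and> H \<subseteq> C \<and> (\<forall>h\<in>H. int_vec d h) \<and>
     (\<forall>v\<in>C. int_vec d v \<longrightarrow>
        (\<exists>m :: real vec \<Rightarrow> nat. v = vec d (\<lambda>j. \<Sum>h\<in>H. real (m h) * h $ j)))"

definition hilbert_basis :: "nat \<Rightarrow> real vec set \<Rightarrow> real vec set" where
  "hilbert_basis d C = (THE H. hb_generating d C H \<and>
      (\<forall>H'. hb_generating d C H' \<longrightarrow> H' \<subseteq> H \<longrightarrow> H' = H))"

definition rsum :: "real mat \<Rightarrow> nat set \<Rightarrow> real vec" where
  "rsum M R = vec (dim_col M) (\<lambda>j. \<Sum>i\<in>R. M $$ (i,j))"

end

(* In coordinates with respect to the (independent) rows, the integer points of the cone are the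
   nonnegative points of the lattice of all c for which c M is integral, so it suffices to
   determine this lattice: the Hilbert basis consists of its minimal nonzero nonnegative points. If B
   is a nonsingular maximal square submatrix, equimodularity makes the entries of B^-1 M lie in
   {-1, 0, 1} (Cramer's rule), so the rows of B^-1 generate the lattice, and it makes the nonzero
   entries of each column of B^-1 equal up to sign. For a tu-set the lattice is Z^n, for a te-lace
   B^-1 has entries 1/2, -1/2 and the lattice is generated by Z^n and (1/2, ..., 1/2). In a
   te-interlace every nonzero column has only entries 1, -1, so all half sums of two unit vectors
   are in the lattice. The determinant of a full rank set of lattice points times the
   equideterminant is an integer; this bounds denominators by 2 (thin) and 4 (thick) and shows that in
   the thick case all elements outside Z^n / 2 have the same set of coordinates outside Z / 2, which
   a parity argument shows to be everything. Hence up to half sums there is one further lattice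
   point, which is (1/4, ..., 1/4) or has one entry changed to 3/4. *)
theory Submission
  imports Defs "Jordan_Normal_Form.Gauss_Jordan_Elimination"
begin

section \<open>Minors\<close>

text \<open>The rows of \<open>B^-1\<close> generate the lattice because
  \<open>c = (c B) B^-1\<close>, and \<open>c B\<close> is integral for every lattice point
  \<open>c\<close>. The powers of two in the determinant argument come from lattice points that
  every te-interlace has. One unit vector and the half sums of it with other unit vectors form all
  but one or two rows of the determinant, and each half sum contributes a factor 1/2. So 2^-(n-2)
  times a coordinate, or 2^-(n-3) times a 2 x 2 determinant of coordinates of two lattice points,
  becomes an integer after multiplication by the equideterminant. Against 2^(n-1) this leaves the
  factor 2 for a coordinate; against 2^n it leaves 4 for a coordinate and 8 for the 2 x 2
  determinant. The two alternatives of the thick case arise as follows. Signs do not affect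
  parities, so every vector of half-integers whose doubled coordinates have an even sum lies in the
  lattice. Modulo these vectors the points with all coordinates in 1/4 + \<int>/2 form only two
  classes, represented by the constant 1/4 and by the same vector with one entry raised by 1/2, at
  any position.\<close>

definition minor :: "real mat \<Rightarrow> nat \<Rightarrow> (nat \<Rightarrow> nat) \<Rightarrow> (nat \<Rightarrow> nat) \<Rightarrow> real" where
  "minor M r f g = det (mat r r (\<lambda>(a, b). M $$ (f a, g b)))"

definition row_comb :: "real mat \<Rightarrow> (nat \<Rightarrow> real) \<Rightarrow> real vec" where
  "row_comb M c = vec (dim_col M) (\<lambda>j. \<Sum>i<dim_row M. c i * M $$ (i, j))"

definition lat :: "real mat \<Rightarrow> (nat \<Rightarrow> real) \<Rightarrow> bool" where
  "lat M c \<longleftrightarrow> (\<forall>j<dim_col M. (\<Sum>i<dim_row M. c i * M $$ (i, j)) \<in> \<int>)"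

lemma abs_signof_mult [simp]: "\<bar>signof p * (x::real)\<bar> = \<bar>x\<bar>"
  by (simp add: sign_def abs_mult)

lemma minor_permute_rows:
  assumes "p permutes {0..<r}"
  shows "\<bar>minor M r (f \<circ> p) g\<bar> = \<bar>minor M r f g\<bar>"
proof -
  let ?A = "mat r r (\<lambda>(a, b). M $$ (f a, g b))"
  have "mat r r (\<lambda>(a, b). M $$ ((f \<circ> p) a, g b)) = mat r r (\<lambda>(a, b). ?A $$ (p a, b))"
    using permutes_in_image[OF assms] by (intro eq_matI) auto
  then show ?thesis
    unfolding minor_def using det_permute_rows[of ?A r p] assms by simp
qed

lemma minor_transpose:
  assumes "f ` {..<r} \<subseteq> {..<dim_row M}" "g ` {..<r} \<subseteq> {..<dim_col M}"
  shows "minor M r f g = minor (transpose_mat M) r g f"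
proof -
  have *: "mat r r (\<lambda>(a, b). M $$ (f a, g b)) \<in> carrier_mat r r" by simp
  have "transpose_mat (mat r r (\<lambda>(a, b). M $$ (f a, g b))) = mat r r (\<lambda>(a, b). transpose_mat M $$ (g a, f b))"
    using assms by (intro eq_matI) (auto simp: image_subset_iff)
  from det_transpose[OF *, unfolded this] show ?thesis
    unfolding minor_def by (rule sym)
qed

lemma pick_enum:
  assumes "finite I"
  shows "bij_betw (pick I) {..<card I} I"
proof -
  have "inj_on (pick I) {..<card I}"
  proof (rule inj_onI)
    fix x y assume xy: "x \<in> {..<card I}" "y \<in> {..<card I}" "pick I x = pick I y"
    then show "x = y" using card_pick_le[of x I] card_pick_le[of y I] by (metis lessThan_iff)
  qed
  moreover have "pick I ` {..<card I} \<subseteq> I" by (auto intro: pick_in_set_le)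
  ultimately show ?thesis
    using assms by (simp add: bij_betw_def card_image card_subset_eq)
qed

lemma enum_eq_comp_permutes:
  fixes r :: nat
  assumes f: "bij_betw f {..<r} I" and h: "bij_betw h {..<r} I"
  obtains p where "p permutes {0..<r}" "\<And>a. a < r \<Longrightarrow> f a = h (p a)"
proof -
  define q where "q = (\<lambda>a. if a < r then inv_into {..<r} h (f a) else a)"
  have "bij_betw (inv_into {..<r} h \<circ> f) {..<r} {..<r}"
    using f bij_betw_inv_into[OF h] by (rule bij_betw_trans)
  then have "bij_betw q {..<r} {..<r}"
    by (rule bij_betw_cong[THEN iffD1, rotated]) (simp add: q_def)
  then have "q permutes {..<r}"
    by (rule bij_imp_permutes) (simp add: q_def)
  then have "q permutes {0..<r}" by (simp add: lessThan_atLeast0)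
  moreover have "f a = h (q a)" if "a < r" for a
    using that f h by (auto simp: q_def f_inv_into_f bij_betw_def)
  ultimately show ?thesis by (rule that)
qed

lemma minor_cong:
  assumes "\<And>a. a < r \<Longrightarrow> f a = f' a" "\<And>a. a < r \<Longrightarrow> g a = g' a"
  shows "minor M r f g = minor M r f' g'"
  unfolding minor_def by (rule arg_cong[of _ _ det]) (auto intro!: eq_matI simp: assms)

lemma minor_row_enum:
  assumes "bij_betw f {..<r} R" "bij_betw f' {..<r} R"
  shows "\<bar>minor M r f g\<bar> = \<bar>minor M r f' g\<bar>"
proof -
  obtain p where p: "p permutes {0..<r}" "\<And>a. a < r \<Longrightarrow> f a = f' (p a)"
    using enum_eq_comp_permutes[OF assms] by metis
  then have "minor M r f g = minor M r (f' \<circ> p) g" by (intro minor_cong) auto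
  then show ?thesis using minor_permute_rows[OF p(1)] by simp
qed

lemma minor_enum:
  assumes f: "bij_betw f {..<r} R" "bij_betw f' {..<r} R"
    and g: "bij_betw g {..<r} J" "bij_betw g' {..<r} J"
    and "R \<subseteq> {..<dim_row M}" "J \<subseteq> {..<dim_col M}"
  shows "\<bar>minor M r f g\<bar> = \<bar>minor M r f' g'\<bar>"
proof -
  have im: "f ` {..<r} = R" "f' ` {..<r} = R" "g ` {..<r} = J" "g' ` {..<r} = J"
    using f g by (auto simp: bij_betw_def)
  have "\<bar>minor M r f g\<bar> = \<bar>minor M r f' g\<bar>" by (rule minor_row_enum[OF f])
  also have "\<dots> = \<bar>minor (transpose_mat M) r g f'\<bar>" using minor_transpose[of f' r M g] im assms by simp
  also have "\<dots> = \<bar>minor (transpose_mat M) r g' f'\<bar>" by (rule minor_row_enum[OF g])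
  also have "\<dots> = \<bar>minor M r f' g'\<bar>" using minor_transpose[of f' r M g'] im assms by simp
  finally show ?thesis .
qed

text \<open>The definitions index submatrices by sets, the arguments use enumerations: along these,
  Cramer's rule is the update \<open>g(l := j)\<close> and a cofactor is a composition with
  \<open>skip\<close>, without resorting indices. The order affects only the sign, hence the
  absolute values.\<close>

lemma det_submatrix_minor:
  assumes f: "bij_betw f {..<r} R" and g: "bij_betw g {..<r} J"
    and R: "R \<subseteq> {..<dim_row M}" and J: "J \<subseteq> {..<dim_col M}"
  shows "\<bar>det (submatrix M R J)\<bar> = \<bar>minor M r f g\<bar>"
proof -
  have fin: "finite R" "finite J" using R J finite_subset by auto
  have card: "card R = r" "card J = r" using bij_betw_same_card[OF f] bij_betw_same_card[OF g] by auto
  have "{i. i < dim_row M \<and> i \<in> R} = R" "{j. j < dim_col M \<and> j \<in> J} = J" using R J by auto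
  then have "det (submatrix M R J) = minor M r (pick R) (pick J)"
    by (simp add: submatrix_def minor_def card)
  then show ?thesis
    using minor_enum[OF _ f _ g R J] pick_enum[OF fin(1)] pick_enum[OF fin(2)] card by auto
qed

text \<open>The Gauss-Jordan form is \<open>C = P * A\<close> with \<open>P\<close> invertible. A
  zero row of \<open>C\<close> would make the corresponding row of \<open>P\<close> a linear
  dependency of the rows of \<open>A\<close>, so that row of \<open>P\<close> would vanish. Hence
  every row of \<open>C\<close> has a pivot, and \<open>P\<close> inverts the submatrix of
  \<open>A\<close> in the pivot columns.\<close>

lemma exists_nonzero_maximal_minor_full:
  fixes A :: "real mat"
  assumes A: "A \<in> carrier_mat n d" and ind: "rows_indep A {..<n}"
  obtains g where "inj_on g {..<n}" "g ` {..<n} \<subseteq> {..<d}" "minor A n id g \<noteq> 0"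
proof -
  define C where "C = gauss_jordan_single A"
  note gj = gauss_jordan_single[OF A C_def[symmetric]]
  have C: "C \<in> carrier_mat n d" by (rule gj(2))
  obtain P Q where P: "C = P * A" "P \<in> carrier_mat n n" "Q \<in> carrier_mat n n" "P * Q = 1\<^sub>m n"
    using gj(4) by blast
  obtain g where "pivot_fun C g d" using gj(3) C by (auto simp: row_echelon_form_def)
  note g = pivot_funD[OF _ this, of n] and zero = pivot_fun_zero_row_iff[OF this C]
  have nz: "g i < d" if i: "i < n" for i
  proof (rule ccontr)
    assume "\<not> g i < d"
    then have row0: "row C i = 0\<^sub>v d" using zero[OF i] g(1)[OF _ i] C by auto
    have "(\<Sum>k\<in>{..<n}. P $$ (i, k) * A $$ (k, j)) = 0" if j: "j < d" for j
    proof -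
      have "row C i $ j = 0" using row0 j by simp
      then have "C $$ (i, j) = 0" using C i j by simp
      moreover have "C $$ (i, j) = (\<Sum>k<n. P $$ (i, k) * A $$ (k, j))"
        using i j A P(2) by (auto simp: P(1) scalar_prod_def lessThan_atLeast0)
      ultimately show ?thesis by simp
    qed
    then have P0: "\<forall>k\<in>{..<n}. P $$ (i, k) = 0"
      using ind A unfolding rows_indep_def by (metis carrier_matD(2))
    have "(P * Q) $$ (i, i) = (\<Sum>k<n. P $$ (i, k) * Q $$ (k, i))"
      using i P(2,3) by (auto simp: scalar_prod_def lessThan_atLeast0)
    then show False using P0 P(4) i by simp
  qed
  have dC: "dim_row C = n" using C by simp
  have inj: "inj_on g {..<n}"
  proof (rule inj_onI)
    fix x y assume "x \<in> {..<n}" "y \<in> {..<n}" "g x = g y"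
    then show "x = y" using g(4)[OF dC, of x] g(5)[OF dC, of y x] nz by force
  qed
  have "P * mat n n (\<lambda>(a, b). A $$ (id a, g b)) = 1\<^sub>m n"
  proof (intro eq_matI)
    fix a b assume "a < dim_row (1\<^sub>m n :: real mat)" "b < dim_col (1\<^sub>m n :: real mat)"
    then have ab: "a < n" "b < n" by auto
    then have "(P * mat n n (\<lambda>(a, b). A $$ (id a, g b))) $$ (a, b) = C $$ (a, g b)"
      using A P(2) nz by (auto simp: P(1) scalar_prod_def)
    also have "\<dots> = 1\<^sub>m n $$ (a, b)" using ab g(4,5)[OF dC] nz by auto
    finally show "(P * mat n n (\<lambda>(a, b). A $$ (id a, g b))) $$ (a, b) = 1\<^sub>m n $$ (a, b)" .
  qed (use P(2) in auto)
  then have "det P * minor A n id g = 1"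
    unfolding minor_def using det_mult[OF P(2), of "mat n n (\<lambda>(a, b). A $$ (id a, g b))"] by simp
  then have "minor A n id g \<noteq> 0" by auto
  then show ?thesis using that[OF inj] nz by auto
qed

lemma exists_nonzero_maximal_minor:
  assumes f: "bij_betw f {..<r} R" and ind: "rows_indep M R"
  obtains g where "inj_on g {..<r}" "g ` {..<r} \<subseteq> {..<dim_col M}" "minor M r f g \<noteq> 0"
proof -
  define A where "A = mat r (dim_col M) (\<lambda>(a, j). M $$ (f a, j))"
  have A: "A \<in> carrier_mat r (dim_col M)" by (simp add: A_def)
  have ind': "rows_indep A {..<r}"
    unfolding rows_indep_def
  proof (intro allI impI ballI)
    fix c :: "nat \<Rightarrow> real" and a
    assume 0: "\<forall>j<dim_col A. (\<Sum>i\<in>{..<r}. c i * A $$ (i, j)) = 0" and a: "a \<in> {..<r}"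
    let ?c = "\<lambda>i. c (inv_into {..<r} f i)"
    have "(\<Sum>i\<in>R. ?c i * M $$ (i, j)) = 0" if j: "j < dim_col M" for j
    proof -
      have "(\<Sum>i\<in>R. ?c i * M $$ (i, j)) = (\<Sum>i\<in>{..<r}. ?c (f i) * M $$ (f i, j))"
        by (rule sum.reindex_bij_betw[OF f, symmetric])
      also have "\<dots> = (\<Sum>i\<in>{..<r}. c i * A $$ (i, j))"
        using f j by (intro sum.cong) (auto simp: A_def bij_betw_def)
      finally show ?thesis using 0 j by (simp add: A_def)
    qed
    then have "\<forall>i\<in>R. ?c i = 0" using ind[unfolded rows_indep_def, THEN spec[of _ ?c]] by simp
    then have "?c (f a) = 0" using f a by (auto simp: bij_betw_def)
    then show "c a = 0" using f a by (auto simp: bij_betw_def)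
  qed
  then obtain g where g: "inj_on g {..<r}" "g ` {..<r} \<subseteq> {..<dim_col M}" "minor A r id g \<noteq> 0"
    using exists_nonzero_maximal_minor_full[OF A ind'] by blast
  have "minor A r id g = minor M r f g"
    unfolding minor_def by (rule arg_cong[of _ _ det]) (use g(2) in \<open>auto intro!: eq_matI simp: A_def image_subset_iff\<close>)
  then have "minor M r f g \<noteq> 0" using g(3) by simp
  with g(1,2) show ?thesis by (rule that)
qed

lemma pick_lessThan:
  assumes "i < k"
  shows "pick {..<k} i = i"
proof -
  have "{a \<in> {..<k}. a < i} = {..<i}" using assms by auto
  then show ?thesis using pick_card_in_set[of i "{..<k}"] assms by simp
qed

text \<open>\<open>rowsub\<close> renumbers the chosen rows as \<open>{..<card R}\<close>; this
  undoes the renumbering when a property of the smaller matrix is read as one of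
  \<open>M\<close>.\<close>

lemma submatrix_rowsub:
  assumes "R \<subseteq> {..<dim_row M}" "J \<subseteq> {..<dim_col M}"
  shows "submatrix (rowsub M R) {..<card R} J = submatrix M R J"
proof -
  have *: "{i. i < dim_row M \<and> i \<in> R} = R" "{j. j < dim_col M \<and> j \<in> J} = J" using assms by auto
  show ?thesis
    unfolding rowsub_def submatrix_def * using pick_in_set[of _ J] assms(2) *
    by (intro eq_matI) (auto simp: pick_lessThan subset_eq)
qed

lemma rowsub_all:
  assumes "M \<in> carrier_mat n d"
  shows "rowsub M {..<n} = M"
proof -
  show ?thesis
    unfolding rowsub_def submatrix_def using assms by (intro eq_matI) (auto simp: pick_lessThan)
qed

section \<open>The lattice of integral coordinates\<close>

definition skip :: "nat \<Rightarrow> nat \<Rightarrow> nat" where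
  "skip s a = (if a < s then a else Suc a)"

text \<open>The inverse of the submatrix with rows \<open>f\<close> and columns \<open>g\<close>, as
  adjugate over determinant, so that each entry is a quotient of minors up to sign. The first index
  belongs to the columns \<open>g\<close> of the submatrix, the second one to its rows
  \<open>f\<close>.\<close>

definition binv :: "real mat \<Rightarrow> nat \<Rightarrow> (nat \<Rightarrow> nat) \<Rightarrow> (nat \<Rightarrow> nat) \<Rightarrow> nat \<Rightarrow> nat \<Rightarrow> real" where
  "binv M r f g l s = adj_mat (mat r r (\<lambda>(a, b). M $$ (f a, g b))) $$ (l, s) / minor M r f g"

lemma binv_left:
  assumes "minor M r f g \<noteq> 0" "l < r" "k < r"
  shows "(\<Sum>s<r. binv M r f g l s * M $$ (f s, g k)) = (if l = k then 1 else 0)"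
proof -
  let ?B = "mat r r (\<lambda>(a, b). M $$ (f a, g b))"
  have B: "?B \<in> carrier_mat r r" by simp
  note adj = adj_mat(1,3)[OF B]
  have "(\<Sum>s<r. adj_mat ?B $$ (l, s) * M $$ (f s, g k)) = (adj_mat ?B * ?B) $$ (l, k)"
    using adj(1) assms(2,3) by (simp add: scalar_prod_def lessThan_atLeast0)
  also have "\<dots> = (if l = k then minor M r f g else 0)"
    unfolding adj(2) using assms(2,3) by (simp add: minor_def)
  finally show ?thesis
    using assms(1) by (simp add: binv_def flip: sum_divide_distrib)
qed

lemma binv_right:
  assumes "minor M r f g \<noteq> 0" "s < r" "t < r"
  shows "(\<Sum>k<r. M $$ (f s, g k) * binv M r f g k t) = (if s = t then 1 else 0)"
proof -
  let ?B = "mat r r (\<lambda>(a, b). M $$ (f a, g b))"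
  have B: "?B \<in> carrier_mat r r" by simp
  note adj = adj_mat(1,2)[OF B]
  have "(\<Sum>k<r. M $$ (f s, g k) * adj_mat ?B $$ (k, t)) = (?B * adj_mat ?B) $$ (s, t)"
    using adj(1) assms(2,3) by (simp add: scalar_prod_def lessThan_atLeast0)
  also have "\<dots> = (if s = t then minor M r f g else 0)"
    unfolding adj(2) using assms(2,3) by (simp add: minor_def)
  finally show ?thesis
    using assms(1) by (simp add: binv_def flip: sum_divide_distrib)
qed

lemma abs_binv:
  assumes "l < r" "s < r"
  shows "\<bar>binv M r f g l s\<bar> = \<bar>minor M (r - 1) (f \<circ> skip s) (g \<circ> skip l)\<bar> / \<bar>minor M r f g\<bar>"
proof -
  let ?B = "mat r r (\<lambda>(a, b). M $$ (f a, g b))"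
  have "mat_delete ?B s l = mat (r - 1) (r - 1) (\<lambda>(a, b). M $$ ((f \<circ> skip s) a, (g \<circ> skip l) b))"
    unfolding mat_delete_def skip_def using assms by (intro eq_matI) auto
  then have "\<bar>adj_mat ?B $$ (l, s)\<bar> = \<bar>minor M (r - 1) (f \<circ> skip s) (g \<circ> skip l)\<bar>"
    using assms by (simp add: adj_mat_def cofactor_def minor_def abs_mult power_abs)
  then show ?thesis by (simp add: binv_def)
qed

text \<open>Cramer's rule: the vector \<open>x\<close> of these sums solves the linear system with
  right-hand side column \<open>j\<close>, and replacing column \<open>l\<close> of the submatrix by
  that column yields the minor along \<open>g(l := j)\<close>.\<close>

lemma binv_column:
  assumes "minor M r f g \<noteq> 0" "l < r"
  shows "(\<Sum>s<r. binv M r f g l s * M $$ (f s, j)) * minor M r f g = minor M r f (g(l := j))"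
proof -
  let ?B = "mat r r (\<lambda>(a, b). M $$ (f a, g b))"
  define v where "v = vec r (\<lambda>s. M $$ (f s, j))"
  define x where "x = vec r (\<lambda>k. \<Sum>t<r. binv M r f g k t * M $$ (f t, j))"
  have "?B *\<^sub>v x = v"
  proof (intro eq_vecI)
    fix s assume "s < dim_vec v"
    then have s: "s < r" by (simp add: v_def)
    have "(?B *\<^sub>v x) $ s = (\<Sum>k<r. M $$ (f s, g k) * (\<Sum>t<r. binv M r f g k t * M $$ (f t, j)))"
      using s by (simp add: x_def scalar_prod_def lessThan_atLeast0)
    also have "\<dots> = (\<Sum>k<r. \<Sum>t<r. M $$ (f s, g k) * binv M r f g k t * M $$ (f t, j))"
      by (simp add: sum_distrib_left mult.assoc)
    also have "\<dots> = (\<Sum>t<r. \<Sum>k<r. M $$ (f s, g k) * binv M r f g k t * M $$ (f t, j))"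
      by (rule sum.swap)
    also have "\<dots> = (\<Sum>t<r. (\<Sum>k<r. M $$ (f s, g k) * binv M r f g k t) * M $$ (f t, j))"
      by (simp add: sum_distrib_right)
    also have "\<dots> = (\<Sum>t<r. (if s = t then 1 else 0) * M $$ (f t, j))"
      using binv_right[OF assms(1) s] by (intro sum.cong) auto
    also have "\<dots> = (\<Sum>t<r. if s = t then M $$ (f t, j) else 0)"
      by (intro sum.cong) auto
    also have "\<dots> = v $ s" using s by (simp add: v_def)
    finally show "(?B *\<^sub>v x) $ s = v $ s" .
  qed (simp add: v_def)
  moreover have "replace_col ?B v l = mat r r (\<lambda>(a, b). M $$ (f a, (g(l := j)) b))"
    unfolding replace_col_def v_def by (intro eq_matI) auto
  moreover have "det (replace_col ?B (?B *\<^sub>v x) l) = x $ l * det ?B"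
    by (rule cramer_lemma_mat) (use assms(2) in \<open>auto simp: x_def\<close>)
  ultimately show ?thesis
    using assms(2) by (simp add: minor_def x_def)
qed

text \<open>In \<open>g(l := j)\<close> the new column may already be selected. Equimodularity
  compares sets of columns and says nothing about this case, but the minor is then zero.\<close>

lemma minor_not_inj:
  assumes "\<not> inj_on g {..<r}"
  shows "minor M r f g = 0"
proof -
  obtain x y where xy: "x < r" "y < r" "x \<noteq> y" "g x = g y"
    using assms by (auto simp: inj_on_def)
  show ?thesis
    unfolding minor_def
    by (rule det_identical_columns[OF _ xy(3,1,2)]) (use xy in \<open>auto simp: col_def\<close>)
qed

lemma rows_indep_subset:
  assumes "rows_indep M R" "R' \<subseteq> R" "finite R"
  shows "rows_indep M R'"
  unfolding rows_indep_def
proof (intro allI impI)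
  fix c :: "nat \<Rightarrow> real"
  assume 0: "\<forall>j<dim_col M. (\<Sum>i\<in>R'. c i * M $$ (i, j)) = 0"
  let ?c = "\<lambda>i. if i \<in> R' then c i else 0"
  have "(\<Sum>i\<in>R. ?c i * M $$ (i, j)) = (\<Sum>i\<in>R'. c i * M $$ (i, j))" for j
    using assms(2,3) by (intro sum.mono_neutral_cong_right) auto
  then have "\<forall>i\<in>R. ?c i = 0"
    using assms(1)[unfolded rows_indep_def, THEN spec[of _ ?c]] 0 by simp
  then show "\<forall>i\<in>R'. c i = 0" using assms(2) by (metis subset_iff)
qed

lemma bij_betw_skip:
  assumes "bij_betw f {..<r} R" "s < r"
  shows "bij_betw (f \<circ> skip s) {..<r - 1} (R - {f s})"
proof -
  have inj: "inj_on (skip s) {..<r - 1}" by (auto simp: inj_on_def skip_def split: if_splits)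
  moreover have "skip s ` {..<r - 1} = {..<r} - {s}"
  proof (intro card_subset_eq)
    show "card (skip s ` {..<r - 1}) = card ({..<r} - {s})"
      using card_image[OF inj] assms(2) by simp
  qed (use assms(2) in \<open>auto simp: skip_def\<close>)
  ultimately have "bij_betw (skip s) {..<r - 1} ({..<r} - {s})" by (simp add: bij_betw_def)
  moreover have "bij_betw f ({..<r} - {s}) (R - {f s})"
    using assms by (auto simp: bij_betw_def inj_on_def)
  ultimately show ?thesis by (rule bij_betw_trans)
qed

lemma inj_on_comp_skip:
  assumes "inj_on g {..<r}" "g ` {..<r} \<subseteq> J" "l < r"
  shows "inj_on (g \<circ> skip l) {..<r - 1}" "(g \<circ> skip l) ` {..<r - 1} \<subseteq> J"
  using bij_betw_skip[of g r "g ` {..<r}" l] assms by (auto simp: bij_betw_def)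

lemma te_minor_abs_eq:
  assumes te: "te_mat M" and ind: "rows_indep M R" and R: "R \<subseteq> {..<dim_row M}"
    and f: "bij_betw f {..<r} R"
    and g: "inj_on g {..<r}" "g ` {..<r} \<subseteq> {..<dim_col M}" "minor M r f g \<noteq> 0"
    and g': "inj_on g' {..<r}" "g' ` {..<r} \<subseteq> {..<dim_col M}" "minor M r f g' \<noteq> 0"
  shows "\<bar>minor M r f g\<bar> = \<bar>minor M r f g'\<bar>"
proof -
  have 1: "\<bar>det (submatrix M R (g ` {..<r}))\<bar> = \<bar>minor M r f g\<bar>"
    using det_submatrix_minor[OF f _ R g(2)] g(1) by (simp add: bij_betw_def)
  have 2: "\<bar>det (submatrix M R (g' ` {..<r}))\<bar> = \<bar>minor M r f g'\<bar>"
    using det_submatrix_minor[OF f _ R g'(2)] g'(1) by (simp add: bij_betw_def)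
  have card: "card R = r" using bij_betw_same_card[OF f] by simp
  have "card (g ` {..<r}) = card R" "card (g' ` {..<r}) = card R"
    using g(1) g'(1) card by (simp_all add: card_image)
  moreover have "det (submatrix M R (g ` {..<r})) \<noteq> 0" "det (submatrix M R (g' ` {..<r})) \<noteq> 0"
    using 1 2 g(3) g'(3) by auto
  ultimately show ?thesis
    using te[unfolded te_mat_def, rule_format, OF R ind g(2) g'(2)] 1 2 by simp
qed

lemma te_binv_column:
  assumes te: "te_mat M" and ind: "rows_indep M R" and R: "R \<subseteq> {..<dim_row M}"
    and f: "bij_betw f {..<r} R"
    and g: "inj_on g {..<r}" "g ` {..<r} \<subseteq> {..<dim_col M}" "minor M r f g \<noteq> 0"
    and l: "l < r" and j: "j < dim_col M"
  shows "(\<Sum>s<r. binv M r f g l s * M $$ (f s, j)) \<in> {-1, 0, 1}"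
proof -
  let ?x = "\<Sum>s<r. binv M r f g l s * M $$ (f s, j)"
  have x: "?x * minor M r f g = minor M r f (g(l := j))"
    by (rule binv_column[OF g(3) l])
  show ?thesis
  proof (cases "minor M r f (g(l := j)) = 0")
    case True
    then show ?thesis using x g(3) by simp
  next
    case False
    have "inj_on (g(l := j)) {..<r}" using False minor_not_inj by blast
    moreover have "(g(l := j)) ` {..<r} \<subseteq> {..<dim_col M}" using g(2) j by auto
    ultimately have "\<bar>minor M r f g\<bar> = \<bar>minor M r f (g(l := j))\<bar>"
      by (intro te_minor_abs_eq[OF te ind R f g _ _ False])
    then have "\<bar>?x\<bar> * \<bar>minor M r f g\<bar> = \<bar>minor M r f g\<bar>" using x by (metis abs_mult)
    then have "\<bar>?x\<bar> = 1" using g(3) by simp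
    then show ?thesis by (auto simp: abs_if split: if_splits)
  qed
qed

text \<open>Column \<open>s\<close> of the inverse consists, up to sign and the common denominator,
  of maximal minors of the rows without \<open>f s\<close>. These rows are again independent, so
  equimodularity applies to them as well.\<close>

lemma te_binv_abs_eq:
  assumes te: "te_mat M" and ind: "rows_indep M R" and R: "R \<subseteq> {..<dim_row M}"
    and f: "bij_betw f {..<r} R"
    and g: "inj_on g {..<r}" "g ` {..<r} \<subseteq> {..<dim_col M}"
    and l: "l < r" "l' < r" and s: "s < r"
    and nz: "binv M r f g l s \<noteq> 0" "binv M r f g l' s \<noteq> 0"
  shows "\<bar>binv M r f g l s\<bar> = \<bar>binv M r f g l' s\<bar>"
proof -
  have fin: "finite R" using R finite_subset by auto
  have ind': "rows_indep M (R - {f s})" using rows_indep_subset[OF ind _ fin] by auto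
  have "minor M (r - 1) (f \<circ> skip s) (g \<circ> skip l) \<noteq> 0"
    "minor M (r - 1) (f \<circ> skip s) (g \<circ> skip l') \<noteq> 0"
    using nz abs_binv[OF l(1) s, of M f g] abs_binv[OF l(2) s, of M f g] by auto
  then have "\<bar>minor M (r - 1) (f \<circ> skip s) (g \<circ> skip l)\<bar> = \<bar>minor M (r - 1) (f \<circ> skip s) (g \<circ> skip l')\<bar>"
    using inj_on_comp_skip[OF g l(1)] inj_on_comp_skip[OF g l(2)] R
    by (intro te_minor_abs_eq[OF te ind' _ bij_betw_skip[OF f s]]) auto
  then show ?thesis using abs_binv l s by simp
qed

text \<open>This is \<open>x = (x B) B^-1\<close>. For a lattice point the inner sums are integers,
  so coordinate \<open>s\<close> is an integral combination of the entries in column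
  \<open>s\<close> of the inverse.\<close>

lemma coord_eq_binv:
  assumes "minor M r f g \<noteq> 0" "s < r"
  shows "x s = (\<Sum>l<r. (\<Sum>t<r. x t * M $$ (f t, g l)) * binv M r f g l s)"
proof -
  have "(\<Sum>l<r. (\<Sum>t<r. x t * M $$ (f t, g l)) * binv M r f g l s)
      = (\<Sum>l<r. \<Sum>t<r. x t * (M $$ (f t, g l) * binv M r f g l s))"
    by (simp add: sum_distrib_right mult.assoc)
  also have "\<dots> = (\<Sum>t<r. \<Sum>l<r. x t * (M $$ (f t, g l) * binv M r f g l s))"
    by (rule sum.swap)
  also have "\<dots> = (\<Sum>t<r. x t * (\<Sum>l<r. M $$ (f t, g l) * binv M r f g l s))"
    by (simp add: sum_distrib_left)
  also have "\<dots> = (\<Sum>t<r. x t * (if t = s then 1 else 0))"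
    using binv_right[OF assms(1) _ assms(2)] by (intro sum.cong) auto
  also have "\<dots> = (\<Sum>t<r. if t = s then x t else 0)"
    by (intro sum.cong) auto
  also have "\<dots> = x s" using assms(2) by simp
  finally show ?thesis by simp
qed

lemma det_Ints:
  fixes A :: "real mat"
  assumes A: "A \<in> carrier_mat n n" and "\<And>i j. i < n \<Longrightarrow> j < n \<Longrightarrow> A $$ (i, j) \<in> \<int>"
  shows "det A \<in> \<int>"
  unfolding det_def'[OF A]
proof (intro Ints_sum Ints_mult Ints_prod)
  fix p assume p: "p \<in> {p. p permutes {0..<n}}"
  show "signof p \<in> (\<int> :: real set)" by (simp add: sign_def)
  fix i assume "i \<in> {0..<n}"
  then show "A $$ (i, p i) \<in> \<int>"
    using permutes_in_image[of p "{0..<n}" i] p by (intro assms(2)) auto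
qed

lemma pm_mat_Ints:
  assumes "pm_mat M" "i < dim_row M" "j < dim_col M"
  shows "M $$ (i, j) \<in> \<int>"
proof -
  have "M $$ (i, j) \<in> {-1, 0, 1}" using assms by (auto simp: pm_mat_def)
  then show ?thesis by auto
qed

lemma minor_Ints:
  assumes "pm_mat M" "f ` {..<r} \<subseteq> {..<dim_row M}" "g ` {..<r} \<subseteq> {..<dim_col M}"
  shows "minor M r f g \<in> \<int>"
  unfolding minor_def
proof (rule det_Ints)
  fix i j assume "i < r" "j < r"
  then show "mat r r (\<lambda>(a, b). M $$ (f a, g b)) $$ (i, j) \<in> \<int>"
    using pm_mat_Ints[OF assms(1), of "f i" "g j"] assms(2,3) by auto
qed simp

lemma tu_set_minor:
  assumes tu: "tu_set M R" and f: "bij_betw f {..<r} R"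
    and g: "inj_on g {..<r}" "g ` {..<r} \<subseteq> {..<dim_col M}"
  shows "minor M r f g \<in> {-1, 0, 1}"
proof -
  have R: "R \<subseteq> {..<dim_row M}" and tum: "tu_mat (rowsub M R)" using tu by (auto simp: tu_set_def)
  have card: "card R = r" "card (g ` {..<r}) = r"
    using bij_betw_same_card[OF f] g(1) by (simp_all add: card_image)
  have "{i. i < dim_row M \<and> i \<in> R} = R" using R by auto
  then have dims: "dim_row (rowsub M R) = r" "dim_col (rowsub M R) = dim_col M"
    by (simp_all add: rowsub_def dim_submatrix card)
  have "det (submatrix (rowsub M R) {..<card R} (g ` {..<r})) \<in> {-1, 0, 1}"
    using tum[unfolded tu_mat_def, rule_format, of "{..<card R}" "g ` {..<r}"] g card dims by simp
  then have "det (submatrix M R (g ` {..<r})) \<in> {-1, 0, 1}"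
    using submatrix_rowsub[OF R g(2)] by simp
  then have "\<bar>minor M r f g\<bar> \<in> {0, 1}"
    using det_submatrix_minor[OF f _ R g(2)] g(1) by (auto simp: bij_betw_def)
  then show ?thesis by (auto simp: abs_if split: if_splits)
qed

section \<open>Lattice points supported on a subset of the rows\<close>

lemma sum_supported:
  fixes c :: "nat \<Rightarrow> real"
  assumes f: "bij_betw f {..<r} R" and "R \<subseteq> {..<n}" "\<And>i. i < n \<Longrightarrow> i \<notin> R \<Longrightarrow> c i = 0"
  shows "(\<Sum>i<n. c i * m i) = (\<Sum>s<r. c (f s) * m (f s))"
proof -
  have "(\<Sum>i<n. c i * m i) = (\<Sum>i\<in>R. c i * m i)"
    using assms by (intro sum.mono_neutral_right) auto
  then show ?thesis using sum.reindex_bij_betw[OF f, of "\<lambda>i. c i * m i"] by simp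
qed

lemma lat_supported_Ints:
  assumes "lat M c" "bij_betw f {..<r} R" "R \<subseteq> {..<dim_row M}"
    "\<And>i. i < dim_row M \<Longrightarrow> i \<notin> R \<Longrightarrow> c i = 0" "j < dim_col M"
  shows "(\<Sum>t<r. c (f t) * M $$ (f t, j)) \<in> \<int>"
  using assms(1,5) sum_supported[OF assms(2,3,4), where m = "\<lambda>i. M $$ (i, j)"] by (auto simp: lat_def)

lemma lat_of_Ints:
  assumes "pm_mat M" "\<And>i. i < dim_row M \<Longrightarrow> c i \<in> \<int>"
  shows "lat M c"
  unfolding lat_def using assms pm_mat_Ints by (auto intro!: Ints_sum Ints_mult)

lemma lat_add: "lat M c \<Longrightarrow> lat M c' \<Longrightarrow> lat M (\<lambda>i. c i + c' i)"
  unfolding lat_def by (auto simp: distrib_right sum.distrib)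

lemma lat_diff: "lat M c \<Longrightarrow> lat M c' \<Longrightarrow> lat M (\<lambda>i. c i - c' i)"
  unfolding lat_def by (auto simp: left_diff_distrib sum_subtractf)

lemma lat_cong: "(\<And>i. i < dim_row M \<Longrightarrow> c i = c' i) \<Longrightarrow> lat M c \<longleftrightarrow> lat M c'"
  unfolding lat_def by simp

text \<open>A nonzero maximal minor of a tu-set is 1 or -1, so the inverse is integral. The form for
  points supported on \<open>R\<close> is what te-laces require, where the tu-sets are the proper
  subsets of the rows.\<close>

lemma tu_set_lat_Ints:
  assumes tu: "tu_set M R" and c: "lat M c" "\<And>i. i < dim_row M \<Longrightarrow> i \<notin> R \<Longrightarrow> c i = 0" and i: "i \<in> R"
  shows "c i \<in> \<int>"
proof -
  have R: "R \<subseteq> {..<dim_row M}" and ind: "rows_indep M R" and pm: "pm_mat M"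
    using tu by (auto simp: tu_set_def)
  define f where "f = pick R"
  have f: "bij_betw f {..<card R} R"
    unfolding f_def using pick_enum finite_subset[OF R] by simp
  obtain g where g: "inj_on g {..<card R}" "g ` {..<card R} \<subseteq> {..<dim_col M}" "minor M (card R) f g \<noteq> 0"
    using exists_nonzero_maximal_minor[OF f ind] .
  have fR: "f ` {..<card R} = R" using f by (simp add: bij_betw_def)
  have D: "\<bar>minor M (card R) f g\<bar> = 1" using tu_set_minor[OF tu f g(1,2)] g(3) by auto
  have N: "binv M (card R) f g l s \<in> \<int>" if ls: "l < card R" "s < card R" for l s
  proof -
    have "(f \<circ> skip s) ` {..<card R - 1} \<subseteq> {..<dim_row M}"
      using bij_betw_skip[OF f ls(2)] R by (auto simp: bij_betw_def)
    then have "minor M (card R - 1) (f \<circ> skip s) (g \<circ> skip l) \<in> \<int>"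
      using inj_on_comp_skip(2)[OF g(1,2) ls(1)] by (intro minor_Ints[OF pm])
    then have "\<bar>binv M (card R) f g l s\<bar> \<in> \<int>"
      using abs_binv[OF ls, of M f g] D by simp
    then show ?thesis by (auto simp: abs_if split: if_splits)
  qed
  obtain s where s: "s < card R" "i = f s" using i fR by auto
  have "c (f s) = (\<Sum>l<card R. (\<Sum>t<card R. c (f t) * M $$ (f t, g l)) * binv M (card R) f g l s)"
    by (rule coord_eq_binv[OF g(3) s(1), of "\<lambda>s. c (f s)"])
  moreover have "\<dots> \<in> \<int>"
    using g(2) by (intro Ints_sum Ints_mult N s(1) lat_supported_Ints[OF c(1) f R c(2)]) auto
  ultimately show ?thesis using s(2) by simp
qed

section \<open>Hilbert bases of simplicial cones\<close>

lemma row_comb_inj: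
  assumes "rows_indep M {..<dim_row M}" "row_comb M c = row_comb M c'" "i < dim_row M"
  shows "c i = c' i"
proof -
  have "(\<Sum>i\<in>{..<dim_row M}. (c i - c' i) * M $$ (i, j)) = 0" if j: "j < dim_col M" for j
  proof -
    have "row_comb M c $ j = row_comb M c' $ j" using assms(2) by simp
    then show ?thesis using j by (simp add: row_comb_def left_diff_distrib sum_subtractf)
  qed
  then have "\<forall>i\<in>{..<dim_row M}. c i - c' i = 0"
    using assms(1)[unfolded rows_indep_def, THEN spec[of _ "\<lambda>i. c i - c' i"]] by simp
  then show ?thesis using assms(3) by simp
qed

lemma cone_rows_row_comb:
  "v \<in> cone_rows M \<longleftrightarrow> (\<exists>c. (\<forall>i<dim_row M. 0 \<le> c i) \<and> v = row_comb M c)"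
  by (simp add: cone_rows_def row_comb_def)

lemma int_vec_row_comb: "int_vec (dim_col M) (row_comb M c) \<longleftrightarrow> lat M c"
  by (simp add: int_vec_def lat_def row_comb_def)

text \<open>Lying inside every generating set gives minimality and uniqueness at once, as the
  definite description in \<open>hilbert_basis\<close> demands.\<close>

lemma hilbert_basis_eqI:
  assumes "hb_generating d C H" "\<And>H'. hb_generating d C H' \<Longrightarrow> H \<subseteq> H'"
  shows "hilbert_basis d C = H"
  unfolding hilbert_basis_def using assms by (intro the_equality) blast+

text \<open>Descent: subtract an element of \<open>K\<close> below \<open>c\<close> and repeat. Each
  step lowers four times the coordinate sum by at least 1, since every element of \<open>K\<close>
  has a coordinate of at least 1/4, so the floor of that number is a termination measure although
  coordinates are fractions.\<close>

lemma row_comb_generated: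
  assumes fin: "finite K"
    and K: "\<And>k. k \<in> K \<Longrightarrow> lat M k \<and> (\<exists>i<dim_row M. 1/4 \<le> k i) \<and> (\<forall>i<dim_row M. 0 \<le> k i)"
    and gen: "\<And>c. lat M c \<Longrightarrow> (\<And>i. i < dim_row M \<Longrightarrow> 0 \<le> c i) \<Longrightarrow> \<exists>i<dim_row M. c i \<noteq> 0 \<Longrightarrow>
      \<exists>k\<in>K. \<forall>i<dim_row M. k i \<le> c i"
    and c: "lat M c" "\<And>i. i < dim_row M \<Longrightarrow> 0 \<le> c i"
  shows "\<exists>m::real vec \<Rightarrow> nat. row_comb M c = vec (dim_col M) (\<lambda>j. \<Sum>h\<in>row_comb M ` K. real (m h) * h $ j)"
  using c
proof (induction "nat \<lfloor>4 * (\<Sum>i<dim_row M. c i)\<rfloor>" arbitrary: c rule: less_induct)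
  case less
  let ?H = "row_comb M ` K"
  show ?case
  proof (cases "\<exists>i<dim_row M. c i \<noteq> 0")
    case False
    then show ?thesis by (intro exI[of _ "\<lambda>_. 0"]) (auto simp: row_comb_def)
  next
    case True
    then obtain k where k: "k \<in> K" "\<And>i. i < dim_row M \<Longrightarrow> k i \<le> c i"
      using gen[OF less.prems] by blast
    obtain i0 where i0: "i0 < dim_row M" "1/4 \<le> k i0" using K[OF k(1)] by blast
    have "k i0 \<le> (\<Sum>i<dim_row M. k i)"
      using K[OF k(1)] i0(1) by (intro member_le_sum) auto
    then have k4: "1 \<le> 4 * (\<Sum>i<dim_row M. k i)" using i0(2) by simp
    let ?c = "\<lambda>i. c i - k i"
    have sum: "(\<Sum>i<dim_row M. ?c i) = (\<Sum>i<dim_row M. c i) - (\<Sum>i<dim_row M. k i)"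
      by (simp add: sum_subtractf)
    have "0 \<le> (\<Sum>i<dim_row M. ?c i)" using k(2) by (intro sum_nonneg) auto
    then have "nat \<lfloor>4 * (\<Sum>i<dim_row M. ?c i)\<rfloor> < nat \<lfloor>4 * (\<Sum>i<dim_row M. c i)\<rfloor>"
      using k4 sum by linarith
    moreover have "lat M ?c" using less.prems(1) K[OF k(1)] by (intro lat_diff) auto
    ultimately obtain m :: "real vec \<Rightarrow> nat" where
      m: "row_comb M ?c = vec (dim_col M) (\<lambda>j. \<Sum>h\<in>?H. real (m h) * h $ j)"
      using less.hyps[of ?c] k(2) by auto
    let ?h = "row_comb M k"
    have h: "?h \<in> ?H" using k(1) by simp
    have "row_comb M c = vec (dim_col M) (\<lambda>j. \<Sum>h\<in>?H. real ((m(?h := Suc (m ?h))) h) * h $ j)"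
    proof (intro eq_vecI)
      fix j assume "j < dim_vec (vec (dim_col M) (\<lambda>j. \<Sum>h\<in>?H. real ((m(?h := Suc (m ?h))) h) * h $ j))"
      then have j: "j < dim_col M" by simp
      have "(\<Sum>h\<in>?H. real ((m(?h := Suc (m ?h))) h) * h $ j)
          = (\<Sum>h\<in>?H. real (m h) * h $ j + (if h = ?h then h $ j else 0))"
        by (intro sum.cong) (auto simp: algebra_simps)
      also have "\<dots> = (\<Sum>h\<in>?H. real (m h) * h $ j) + ?h $ j"
        using fin h by (simp add: sum.distrib)
      also have "(\<Sum>h\<in>?H. real (m h) * h $ j) = row_comb M ?c $ j" using m j by simp
      also have "row_comb M ?c $ j + ?h $ j = row_comb M c $ j"
        using j by (simp add: row_comb_def left_diff_distrib sum_subtractf)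
      finally show "row_comb M c $ j
          = vec (dim_col M) (\<lambda>j. \<Sum>h\<in>?H. real ((m(?h := Suc (m ?h))) h) * h $ j) $ j"
        using j by simp
    qed (simp add: row_comb_def)
    then show ?thesis by (rule exI[of _ "m(?h := Suc (m ?h))"])
  qed
qed

text \<open>Independence turns a representation of \<open>row_comb M k\<close> by elements of
  \<open>H\<close> into one of coordinates. All terms are nonnegative, so an element used at a
  positive coordinate of \<open>k\<close> has coordinates below \<open>k\<close> and is not zero;
  irreducibility identifies it with \<open>k\<close>.\<close>

lemma irreducible_in_hb_generating:
  assumes ind: "rows_indep M {..<dim_row M}"
    and gen: "hb_generating (dim_col M) (cone_rows M) H"
    and k: "lat M k" "\<And>i. i < dim_row M \<Longrightarrow> 0 \<le> k i" "\<exists>i<dim_row M. 0 < k i"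
    and irr: "\<And>u. lat M u \<Longrightarrow> (\<And>i. i < dim_row M \<Longrightarrow> 0 \<le> u i \<and> u i \<le> k i) \<Longrightarrow>
      (\<forall>i<dim_row M. u i = 0) \<or> (\<forall>i<dim_row M. u i = k i)"
  shows "row_comb M k \<in> H"
proof -
  have fin: "finite H" using gen by (simp add: hb_generating_def)
  have "\<exists>c. (\<forall>i<dim_row M. 0 \<le> c i) \<and> h = row_comb M c" if "h \<in> H" for h
    using gen that cone_rows_row_comb by (auto simp: hb_generating_def)
  then obtain \<gamma> where \<gamma>: "\<And>h i. h \<in> H \<Longrightarrow> i < dim_row M \<Longrightarrow> 0 \<le> \<gamma> h i"
      "\<And>h. h \<in> H \<Longrightarrow> h = row_comb M (\<gamma> h)"
    by metis
  have lat: "lat M (\<gamma> h)" if "h \<in> H" for h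
    using gen \<gamma>(2)[OF that] that int_vec_row_comb by (metis hb_generating_def)
  have "row_comb M k \<in> cone_rows M" using k(2) cone_rows_row_comb by blast
  then obtain m :: "real vec \<Rightarrow> nat" where
    m: "row_comb M k = vec (dim_col M) (\<lambda>j. \<Sum>h\<in>H. real (m h) * h $ j)"
    using gen k(1) int_vec_row_comb unfolding hb_generating_def by metis
  let ?s = "\<lambda>i. \<Sum>h\<in>H. real (m h) * \<gamma> h i"
  have "row_comb M k = row_comb M ?s"
  proof (intro eq_vecI)
    fix j assume "j < dim_vec (row_comb M ?s)"
    then have j: "j < dim_col M" by (simp add: row_comb_def)
    have "row_comb M k $ j = (\<Sum>h\<in>H. real (m h) * (row_comb M (\<gamma> h)) $ j)"
      using m j \<gamma>(2) by (simp cong: sum.cong)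
    also have "\<dots> = (\<Sum>h\<in>H. \<Sum>i<dim_row M. real (m h) * \<gamma> h i * M $$ (i, j))"
      using j by (simp add: row_comb_def sum_distrib_left mult.assoc)
    also have "\<dots> = (\<Sum>i<dim_row M. \<Sum>h\<in>H. real (m h) * \<gamma> h i * M $$ (i, j))"
      by (rule sum.swap)
    also have "\<dots> = row_comb M ?s $ j" using j by (simp add: row_comb_def sum_distrib_right)
    finally show "row_comb M k $ j = row_comb M ?s $ j" .
  qed (simp add: row_comb_def)
  then have ks: "k i = ?s i" if "i < dim_row M" for i
    using row_comb_inj[OF ind _ that] by blast
  obtain i where i: "i < dim_row M" "0 < k i" using k(3) by blast
  have "\<exists>h\<in>H. real (m h) * \<gamma> h i \<noteq> 0"
  proof (rule ccontr)
    assume "\<not> ?thesis"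
    then have "?s i = 0" by (intro sum.neutral) auto
    then show False using ks i by simp
  qed
  then obtain h where h: "h \<in> H" "m h \<noteq> 0" "\<gamma> h i \<noteq> 0" by auto
  have le: "\<gamma> h i' \<le> k i'" if i': "i' < dim_row M" for i'
  proof -
    have "1 * \<gamma> h i' \<le> real (m h) * \<gamma> h i'"
      using h(1,2) \<gamma>(1)[OF h(1) i'] by (intro mult_right_mono) auto
    also have "\<dots> \<le> ?s i'"
      using h(1) fin \<gamma>(1) i' by (intro member_le_sum) auto
    finally show ?thesis using ks[OF i'] by simp
  qed
  have "(\<forall>i<dim_row M. \<gamma> h i = 0) \<or> (\<forall>i<dim_row M. \<gamma> h i = k i)"
    using \<gamma>(1)[OF h(1)] le by (intro irr lat h(1)) auto
  then have "\<forall>i<dim_row M. \<gamma> h i = k i" using h(3) i by auto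
  then have "row_comb M (\<gamma> h) = row_comb M k" by (simp add: row_comb_def)
  then show ?thesis using h(1) \<gamma>(2)[OF h(1)] by simp
qed

lemma hilbert_basis_cone_rows:
  assumes ind: "rows_indep M {..<dim_row M}" and fin: "finite K"
    and K: "\<And>k. k \<in> K \<Longrightarrow> lat M k \<and> (\<exists>i<dim_row M. 1/4 \<le> k i) \<and> (\<forall>i<dim_row M. 0 \<le> k i)"
    and gen: "\<And>c. lat M c \<Longrightarrow> (\<And>i. i < dim_row M \<Longrightarrow> 0 \<le> c i) \<Longrightarrow> \<exists>i<dim_row M. c i \<noteq> 0 \<Longrightarrow>
      \<exists>k\<in>K. \<forall>i<dim_row M. k i \<le> c i"
    and irr: "\<And>k u. k \<in> K \<Longrightarrow> lat M u \<Longrightarrow> (\<And>i. i < dim_row M \<Longrightarrow> 0 \<le> u i \<and> u i \<le> k i) \<Longrightarrow>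
      (\<forall>i<dim_row M. u i = 0) \<or> (\<forall>i<dim_row M. u i = k i)"
  shows "hilbert_basis (dim_col M) (cone_rows M) = row_comb M ` K"
proof (rule hilbert_basis_eqI)
  show "hb_generating (dim_col M) (cone_rows M) (row_comb M ` K)"
    unfolding hb_generating_def
  proof (intro conjI ballI impI)
    show "row_comb M ` K \<subseteq> cone_rows M" using K cone_rows_row_comb by blast
    show "int_vec (dim_col M) h" if "h \<in> row_comb M ` K" for h
      using that K int_vec_row_comb by blast
    fix v assume "v \<in> cone_rows M" "int_vec (dim_col M) v"
    then obtain c where c: "lat M c" "\<And>i. i < dim_row M \<Longrightarrow> 0 \<le> c i" "v = row_comb M c"
      using cone_rows_row_comb int_vec_row_comb by metis
    show "\<exists>m::real vec \<Rightarrow> nat. v = vec (dim_col M) (\<lambda>j. \<Sum>h\<in>row_comb M ` K. real (m h) * h $ j)"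
      unfolding c(3) by (rule row_comb_generated[OF fin K gen c(1,2)])
  qed (use fin in simp)
  fix H' assume H': "hb_generating (dim_col M) (cone_rows M) H'"
  show "row_comb M ` K \<subseteq> H'"
  proof safe
    fix k assume k: "k \<in> K"
    have "\<exists>i<dim_row M. 0 < k i" using K[OF k] by force
    then show "row_comb M k \<in> H'"
      using K[OF k] by (intro irreducible_in_hb_generating[OF ind H'] irr[OF k]) auto
  qed
qed

section \<open>Te-laces\<close>

lemma te_set_te_mat:
  assumes "M \<in> carrier_mat n d" "te_set M {..<n}"
  shows "te_mat M"
  using assms rowsub_all[of M n d] by (simp add: te_set_def)

lemma minor_0: "minor M 0 f g = 1"
  by (simp add: minor_def)

lemma minor_1: "minor M (Suc 0) f g = M $$ (f 0, g 0)"
  unfolding minor_def by (subst det_single) auto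

lemma minor_2: "minor M 2 f g = M $$ (f 0, g 0) * M $$ (f 1, g 1) - M $$ (f 0, g 1) * M $$ (f 1, g 0)"
proof -
  let ?B = "mat 2 2 (\<lambda>(a, b). M $$ (f a, g b))"
  have 1: "mat_delete ?B 0 0 = mat 1 1 (\<lambda>_. M $$ (f 1, g 1))" "mat_delete ?B 1 0 = mat 1 1 (\<lambda>_. M $$ (f 0, g 1))"
    by (auto intro!: eq_matI simp: mat_delete_def)
  have "det ?B = (\<Sum>i<2. ?B $$ (i, 0) * cofactor ?B i 0)"
    by (rule laplace_expansion_column) auto
  then show ?thesis
    using 1 by (simp add: minor_def cofactor_def numeral_2_eq_2 det_single)
qed

lemma minor_le_1:
  assumes "pm_mat M" "f ` {..<r} \<subseteq> {..<dim_row M}" "g ` {..<r} \<subseteq> {..<dim_col M}" "r \<le> 1"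
  shows "minor M r f g \<in> {-1, 0, 1}"
proof -
  consider "r = 0" | "r = Suc 0" using assms(4) by linarith
  then show ?thesis
  proof cases
    case 2
    then have "f 0 < dim_row M" "g 0 < dim_col M" using assms(2,3) by auto
    then have "M $$ (f 0, g 0) \<in> {-1, 0, 1}" using assms(1) unfolding pm_mat_def by blast
    then show ?thesis using 2 minor_1 by simp
  qed (simp add: minor_0)
qed

lemma te_lace_tu_set_Diff:
  assumes "te_lace M {..<n}" "i < n"
  shows "tu_set M ({..<n} - {i})"
proof -
  have "{..<n} - {i} \<subset> {..<n}" using assms(2) by auto
  then show ?thesis using assms(1) unfolding te_lace_def by blast
qed

text \<open>Subtracting the integral coordinate \<open>i\<close> leaves a lattice point supported on
  the other rows, which form a tu-set. So a lattice point of a te-lace is integral in all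
  coordinates or in none.\<close>

lemma te_lace_coord_Ints:
  assumes lace: "te_lace M {..<n}" and M: "M \<in> carrier_mat n d"
    and c: "lat M c" and i: "i < n" "c i \<in> \<int>" and k: "k < n"
  shows "c k \<in> \<int>"
proof (cases "k = i")
  case False
  have pm: "pm_mat M" using lace by (simp add: te_lace_def te_set_def)
  have tu: "tu_set M ({..<n} - {i})"
    using lace i(1) by (rule te_lace_tu_set_Diff)
  have "lat M (\<lambda>k. if k = i then c i else 0)"
    using lat_of_Ints[OF pm, of "\<lambda>k. if k = i then c i else 0"] i(2) by simp
  then have "lat M (\<lambda>k. c k - (if k = i then c i else 0))"
    by (rule lat_diff[OF c])
  then have "c k - (if k = i then c i else 0) \<in> \<int>"
    using k M False by (intro tu_set_lat_Ints[OF tu, of "\<lambda>k. c k - (if k = i then c i else 0)"]) auto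
  then show ?thesis using False by simp
qed (use i in simp)

lemma half_Ints_cases:
  fixes x :: real
  assumes "2 * x \<in> \<int>"
  shows "x \<in> \<int> \<or> x - 1/2 \<in> \<int>"
proof -
  obtain z where z: "2 * x = of_int z" using assms by (auto elim: Ints_cases)
  show ?thesis
  proof (cases "even z")
    case True
    then have "x = of_int (z div 2)" using z by (simp add: real_of_int_div)
    then show ?thesis by simp
  next
    case False
    then have "x - 1/2 = of_int ((z - 1) div 2)" using z by (simp add: real_of_int_div)
    then show ?thesis by (metis Ints_of_int)
  qed
qed

text \<open>Proper subsets are tu-sets, so a square submatrix violating total unimodularity uses all
  rows. This gives a maximal minor \<open>D\<close> with |D| \<ge> 2, while the cofactors are 0, 1
  or -1. That |D| is exactly 2 results from comparing two rows of the inverse.\<close>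

lemma te_lace_lat:
  assumes lace: "te_lace M {..<n}" and M: "M \<in> carrier_mat n d"
  shows "2 \<le> n" "lat M (\<lambda>_. 1/2)"
    "lat M c \<Longrightarrow> (\<forall>i<n. c i \<in> \<int>) \<or> (\<forall>i<n. c i - 1/2 \<in> \<int>)"
proof -
  have te: "te_mat M" and pm: "pm_mat M" and ind: "rows_indep M {..<n}"
    using lace te_set_te_mat[OF M] by (auto simp: te_lace_def te_set_def)
  have idn: "bij_betw id {..<n} {..<n}" by simp
  have nR: "{..<n} \<subseteq> {..<dim_row M}" using M by auto
  have "\<not> tu_mat M"
    using lace rowsub_all[OF M] nR by (auto simp: te_lace_def te_set_def tu_set_def)
  then obtain R J where RJ: "R \<subseteq> {..<n}" "J \<subseteq> {..<d}" "card R = card J"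
    "det (submatrix M R J) \<notin> {-1, 0, 1}"
    using M by (auto simp: tu_mat_def)
  have RM: "R \<subseteq> {..<dim_row M}" and JM: "J \<subseteq> {..<dim_col M}" using RJ M by auto
  have enum: "bij_betw (pick R) {..<card R} R" "bij_betw (pick J) {..<card R} J"
    using pick_enum[of R] pick_enum[of J] RJ finite_subset by auto
  have R: "R = {..<n}"
  proof (rule ccontr)
    assume "R \<noteq> {..<n}"
    then have "tu_set M R" using lace RJ(1) unfolding te_lace_def by blast
    then have "minor M (card R) (pick R) (pick J) \<in> {-1, 0, 1}"
      using enum JM by (intro tu_set_minor) (auto simp: bij_betw_def)
    then have "\<bar>det (submatrix M R J)\<bar> \<in> {0, 1}"
      using det_submatrix_minor[OF enum RM JM] by auto
    then show False using RJ(4) by (auto simp: abs_if split: if_splits)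
  qed
  define g where "g = pick J"
  have bij: "bij_betw g {..<n} J" using enum(2) R by (simp add: g_def)
  then have g: "inj_on g {..<n}" "g ` {..<n} \<subseteq> {..<dim_col M}" using JM by (auto simp: bij_betw_def)
  define D where "D = minor M n id g"
  have "\<bar>D\<bar> \<notin> {0, 1}"
    using RJ(4) det_submatrix_minor[OF idn bij nR JM] R by (auto simp: D_def abs_if split: if_splits)
  moreover have "\<bar>D\<bar> \<in> \<int>" using minor_Ints[OF pm _ g(2), of id] nR by (simp add: D_def)
  ultimately have D2: "2 \<le> \<bar>D\<bar>" by (auto elim!: Ints_cases)
  then have D0: "minor M n id g \<noteq> 0" by (auto simp: D_def)
  show n2: "2 \<le> n"
  proof (rule ccontr)
    assume "\<not> 2 \<le> n"
    then have "D \<in> {-1, 0, 1}" using minor_le_1[OF pm _ g(2), of id] nR by (simp add: D_def)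
    then show False using D2 by auto
  qed
  define N where "N = binv M n id g"
  have N_lat: "lat M (N l)" if "l < n" for l
    unfolding lat_def
  proof (intro allI impI)
    fix j assume "j < dim_col M"
    then have "(\<Sum>s<n. N l s * M $$ (s, j)) \<in> {-1, 0, 1}"
      using te_binv_column[OF te ind nR idn g D0 that] by (simp add: N_def)
    then show "(\<Sum>i<dim_row M. N l i * M $$ (i, j)) \<in> \<int>" using M by auto
  qed
  have N_left: "(\<Sum>s<n. N l s * M $$ (s, g k)) = (if l = k then 1 else 0)" if "l < n" "k < n" for l k
    using binv_left[OF D0 that] by (simp add: N_def)
  have N_small: "\<bar>N l s\<bar> \<in> {0, 1 / \<bar>D\<bar>}" if "l < n" "s < n" for l s
  proof -
    have "tu_set M ({..<n} - {id s})"
      using te_lace_tu_set_Diff[OF lace that(2)] by simp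
    then have "minor M (n - 1) (id \<circ> skip s) (g \<circ> skip l) \<in> {-1, 0, 1}"
      by (rule tu_set_minor[OF _ bij_betw_skip[OF idn that(2)] inj_on_comp_skip[OF g that(1)]])
    then show ?thesis using abs_binv[OF that, of M id g] by (auto simp: N_def D_def)
  qed
  \<comment> \<open>One integral entry makes the whole row \<open>l\<close> integral; its entries
    have absolute value at most 1/2, so the row is zero, although its product with column
    \<open>g l\<close> is 1.\<close>
  have N_nonint: "N l s \<notin> \<int>" if "l < n" "s < n" for l s
  proof
    assume "N l s \<in> \<int>"
    have "N l t = 0" if t: "t < n" for t
    proof -
      have "N l t \<in> \<int>"
        by (rule te_lace_coord_Ints[OF lace M N_lat]) (use \<open>l < n\<close> \<open>s < n\<close> \<open>N l s \<in> \<int>\<close> t in auto)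
      moreover have "1 / \<bar>D\<bar> \<le> 1/2" using D2 by (simp add: field_simps)
      then have "\<bar>N l t\<bar> < 1" using N_small[OF \<open>l < n\<close> t] by auto
      ultimately show ?thesis by (auto elim!: Ints_cases)
    qed
    then have "(\<Sum>s<n. N l s * M $$ (s, g l)) = 0" by (intro sum.neutral) auto
    then show False using N_left[OF that(1) that(1)] by simp
  qed
  then have N_abs: "\<bar>N l s\<bar> = 1 / \<bar>D\<bar>" if "l < n" "s < n" for l s
    using N_small[OF that] that by force
  have n01: "0 < n" "1 < n" using n2 by auto
  \<comment> \<open>Pairing with column \<open>g 0\<close> gives 1 for row 0 and 0 for row 1, so
    these rows are neither equal nor opposite: their entries are opposite at some \<open>s\<close>
    and equal at some \<open>t\<close>. Their difference is 0 at \<open>t\<close>, hence integral at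
    \<open>s\<close>, where its absolute value is 2/|D|.\<close>
  have "\<exists>s<n. N 0 s \<noteq> N 1 s"
  proof (rule ccontr)
    assume "\<not> ?thesis"
    then have "(\<Sum>s<n. N 0 s * M $$ (s, g 0)) = (\<Sum>s<n. N 1 s * M $$ (s, g 0))"
      by (intro sum.cong) auto
    then show False using N_left[OF n01(1) n01(1)] N_left[OF n01(2) n01(1)] by simp
  qed
  then obtain s where s: "s < n" "N 0 s = - N 1 s"
    using N_abs[OF n01(1)] N_abs[OF n01(2)] by (metis abs_eq_iff)
  have "\<exists>t<n. N 0 t \<noteq> - N 1 t"
  proof (rule ccontr)
    assume "\<not> ?thesis"
    then have "(\<Sum>s<n. N 0 s * M $$ (s, g 0)) = (\<Sum>s<n. - (N 1 s * M $$ (s, g 0)))"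
      by (intro sum.cong) auto
    then show False
      using N_left[OF n01(1) n01(1)] N_left[OF n01(2) n01(1)] by (simp add: sum_negf)
  qed
  then obtain t where t: "t < n" "N 0 t = N 1 t"
    using N_abs[OF n01(1)] N_abs[OF n01(2)] by (metis abs_eq_iff)
  have "N 0 s - N 1 s \<in> \<int>"
    by (rule te_lace_coord_Ints[OF lace M lat_diff[OF N_lat[OF n01(1)] N_lat[OF n01(2)]] t(1) _ s(1)])
      (use t(2) in simp)
  then have "\<bar>2 * N 0 s\<bar> \<in> \<int>" using s(2) by (auto simp: Ints_abs)
  then have "2 / \<bar>D\<bar> \<in> \<int>" using N_abs[OF n01(1) s(1)] by (simp add: abs_mult)
  then obtain z where z: "2 / \<bar>D\<bar> = of_int z" by (rule Ints_cases)
  have "0 < 2 / \<bar>D\<bar>" "2 / \<bar>D\<bar> \<le> 1" using D2 by auto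
  then have "z = 1" unfolding z by linarith
  then have "2 / \<bar>D\<bar> = 1" using z by simp
  then have "\<bar>D\<bar> = 2" by (simp add: field_simps)
  then have N_half: "N l s \<in> {1/2, -1/2}" if "l < n" "s < n" for l s
    using N_abs[OF that] by (auto simp: abs_if split: if_splits)
  \<comment> \<open>Row 0 of the inverse has entries 1/2 and -1/2, so it differs from the constant
    1/2 by an integral vector.\<close>
  have "lat M (\<lambda>i. 1/2 - N 0 i)"
  proof (rule lat_of_Ints[OF pm])
    fix i assume "i < dim_row M"
    then have "N 0 i = 1/2 \<or> N 0 i = -1/2" using N_half[OF n01(1), of i] M by auto
    then have "1/2 - N 0 i = 0 \<or> 1/2 - N 0 i = 1" by linarith
    then show "1/2 - N 0 i \<in> \<int>" by (metis Ints_0 Ints_1)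
  qed
  from lat_add[OF this N_lat[OF n01(1)]] show half: "lat M (\<lambda>_. 1/2)" by simp
  assume c: "lat M c"
  \<comment> \<open>Coordinate 0 decides: once it is known to lie in \<int> or in 1/2 + \<int>, the
    remaining coordinates follow by applying \<open>te_lace_coord_Ints\<close> to \<open>c\<close>
    or to \<open>c\<close> minus the constant 1/2.\<close>
  have "c 0 = (\<Sum>l<n. (\<Sum>t<n. c t * M $$ (t, g l)) * N l 0)"
    using coord_eq_binv[OF D0 n01(1), of c] by (simp add: N_def)
  then have "2 * c 0 = (\<Sum>l<n. (\<Sum>t<n. c t * M $$ (t, g l)) * (2 * N l 0))"
    by (simp add: sum_distrib_left mult.left_commute)
  also have "\<dots> \<in> \<int>"
  proof (rule Ints_sum, rule Ints_mult)
    fix l assume l: "l \<in> {..<n}"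
    then show "(\<Sum>t<n. c t * M $$ (t, g l)) \<in> \<int>" using c g(2) M by (auto simp: lat_def)
    have "2 * N l 0 = 1 \<or> 2 * N l 0 = -1" using N_half[of l 0] l n01(1) by auto
    then show "2 * N l 0 \<in> \<int>" by (metis Ints_1 Ints_minus)
  qed
  finally have "c 0 \<in> \<int> \<or> c 0 - 1/2 \<in> \<int>" by (rule half_Ints_cases)
  then show "(\<forall>i<n. c i \<in> \<int>) \<or> (\<forall>i<n. c i - 1/2 \<in> \<int>)"
    using te_lace_coord_Ints[OF lace M c n01(1)]
      te_lace_coord_Ints[OF lace M lat_diff[OF c half] n01(1)] by auto
qed

section \<open>Te-interlaces\<close>

definition unit_coord :: "nat \<Rightarrow> nat \<Rightarrow> real" where
  "unit_coord a k = (if k = a then 1 else 0)"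

definition half_pair :: "nat \<Rightarrow> nat \<Rightarrow> nat \<Rightarrow> real" where
  "half_pair a b k = (unit_coord a k + unit_coord b k) / 2"

text \<open>The te-lace \<open>{i, j}\<close> has a 2 x 2 minor of absolute value above 1, which for
  entries -1, 0, 1 excludes zero entries. A column with exactly one nonzero entry in these two rows,
  put next to a column of that minor, would give a minor of absolute value 1, against
  equimodularity.\<close>

lemma te_interlace_support:
  assumes inter: "te_interlace M {..<n}" and M: "M \<in> carrier_mat n d"
    and ij: "i < n" "j < n" "i \<noteq> j" and k: "k < d" and ik: "M $$ (i, k) \<noteq> 0"
  shows "M $$ (j, k) \<noteq> 0"
proof
  assume jk: "M $$ (j, k) = 0"
  have te: "te_mat M" and pm: "pm_mat M" and ind: "rows_indep M {..<n}"
    using inter te_set_te_mat[OF M] by (auto simp: te_interlace_def te_set_def)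
  have lace: "te_lace M {i, j}" using inter ij by (auto simp: te_interlace_def)
  have ijM: "{i, j} \<subseteq> {..<dim_row M}" using ij M by auto
  have ind2: "rows_indep M {i, j}" by (rule rows_indep_subset[OF ind]) (use ij in auto)
  define X where "X = rowsub M {i, j}"
  have "\<not> tu_mat X"
    using lace by (auto simp: X_def te_lace_def te_set_def tu_set_def)
  have "{k. k < dim_row M \<and> k \<in> {i, j}} = {i, j}" using ijM by auto
  then have X: "dim_row X = 2" "dim_col X = d"
    using ij(3) M by (simp_all add: X_def rowsub_def dim_submatrix)
  obtain R J where RJ: "R \<subseteq> {..<2}" "J \<subseteq> {..<d}" "card R = card J" "det (submatrix X R J) \<notin> {-1, 0, 1}"
    using \<open>\<not> tu_mat X\<close> X by (auto simp: tu_mat_def)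
  have "pm_mat X"
    unfolding pm_mat_def
  proof (intro allI impI)
    fix a b assume "a < dim_row X" "b < dim_col X"
    then have "X $$ (a, b) = M $$ (pick {i, j} a, pick {..<d} b)" "pick {i, j} a \<in> {i, j}" "b < d"
      using X M ij(3) pick_in_set_le[of a "{i, j}"]
      by (auto simp: X_def rowsub_def submatrix_index dim_submatrix)
    then show "X $$ (a, b) \<in> {-1, 0, 1}"
      using pm M ij unfolding pm_mat_def by (metis carrier_matD insertE pick_lessThan singletonD)
  qed
  have enum: "bij_betw (pick R) {..<card R} R" "bij_betw (pick J) {..<card R} J"
    using pick_enum[of R] pick_enum[of J] RJ finite_subset by auto
  have RX: "R \<subseteq> {..<dim_row X}" "J \<subseteq> {..<dim_col X}" using RJ X by auto
  have "\<not> card R \<le> 1"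
  proof
    assume "card R \<le> 1"
    then have "minor X (card R) (pick R) (pick J) \<in> {-1, 0, 1}"
      using enum RX by (intro minor_le_1 \<open>pm_mat X\<close>) (auto simp: bij_betw_def)
    then show False
      using RJ(4) det_submatrix_minor[OF enum RX] by (auto simp: abs_if split: if_splits)
  qed
  moreover have "card R \<le> 2" using card_mono[OF _ RJ(1)] by simp
  ultimately have "card R = 2" by simp
  then have R: "R = {..<2}" by (intro card_subset_eq) (use RJ(1) in auto)
  have cJ: "card J = 2" using RJ(3) R by simp
  have cij: "card {i, j} = 2" using ij(3) by simp
  have det: "det (submatrix M {i, j} J) \<notin> {-1, 0, 1}"
    using RJ(2,4) submatrix_rowsub[OF ijM, of J] M R cij by (simp add: X_def)
  define g where "g = pick J"
  define f where "f = (\<lambda>a::nat. if a = 0 then i else j)"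
  have two: "{..<2} = {0, 1 :: nat}" by auto
  have f: "bij_betw f {..<2} {i, j}"
    using ij(3) by (auto simp: f_def bij_betw_def two)
  have bij: "bij_betw g {..<2} J" using enum(2) \<open>card R = 2\<close> by (simp add: g_def)
  have JM: "J \<subseteq> {..<dim_col M}" using RJ(2) M by simp
  have g: "inj_on g {..<2}" "g ` {..<2} \<subseteq> {..<dim_col M}" using bij JM by (auto simp: bij_betw_def)
  have gd: "g 0 < d" "g 1 < d" using g(2) M by (auto simp: two)
  have m: "\<bar>minor M 2 f g\<bar> \<notin> {0, 1}"
    using det det_submatrix_minor[OF f bij ijM JM] by (auto simp: abs_if split: if_splits)
  have m2: "minor M 2 f g = M $$ (i, g 0) * M $$ (j, g 1) - M $$ (i, g 1) * M $$ (j, g 0)"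
    by (simp add: minor_2 f_def)
  have e: "M $$ (a, b) \<in> {-1, 0, 1}" if "a < n" "b < d" for a b
    using pm that M unfolding pm_mat_def by (metis carrier_matD)
  have u: "M $$ (j, g 0) \<in> {-1, 1}"
    using e[OF ij(1) gd(1)] e[OF ij(1) gd(2)] e[OF ij(2) gd(1)] e[OF ij(2) gd(2)] m m2 by auto
  define g' where "g' = (\<lambda>a::nat. if a = 0 then k else g 0)"
  have m': "minor M 2 f g' = M $$ (i, k) * M $$ (j, g 0)"
    by (simp add: minor_2 f_def g'_def jk)
  have m'1: "\<bar>minor M 2 f g'\<bar> = 1"
    using m' u e[OF ij(1) k] ik by auto
  have "k \<noteq> g 0" using u jk by auto
  then have g': "inj_on g' {..<2}" "g' ` {..<2} \<subseteq> {..<dim_col M}"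
    using k gd M by (auto simp: g'_def two)
  have "\<bar>minor M 2 f g\<bar> = \<bar>minor M 2 f g'\<bar>"
    by (rule te_minor_abs_eq[OF te ind2 ijM f g _ g']) (use m m'1 in auto)
  then show False using m m'1 by simp
qed

lemma te_interlace_entry:
  assumes inter: "te_interlace M {..<n}" and M: "M \<in> carrier_mat n d"
    and i: "i < n" and k: "k < d" and nz: "i' < n" "M $$ (i', k) \<noteq> 0"
  shows "M $$ (i, k) = 1 \<or> M $$ (i, k) = -1"
proof -
  have "M $$ (i, k) \<noteq> 0"
    using te_interlace_support[OF inter M nz(1) i _ k nz(2)] nz(2) by (cases "i' = i") auto
  moreover have "M $$ (i, k) \<in> {-1, 0, 1}"
    using inter M i k unfolding te_interlace_def te_set_def pm_mat_def by (metis carrier_matD)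
  ultimately show ?thesis by auto
qed

lemma te_interlace_half_sum:
  assumes inter: "te_interlace M {..<n}" and M: "M \<in> carrier_mat n d"
    and "a < n" "b < n" and k: "k < d"
  shows "(M $$ (a, k) + M $$ (b, k)) / 2 \<in> \<int>"
proof (cases "M $$ (a, k) = 0")
  case True
  then have "M $$ (b, k) = 0"
    using te_interlace_entry[OF inter M assms(3) k assms(4)] by auto
  then show ?thesis using True by simp
next
  case False
  then have "M $$ (a, k) = 1 \<or> M $$ (a, k) = -1" "M $$ (b, k) = 1 \<or> M $$ (b, k) = -1"
    using te_interlace_entry[OF inter M _ k assms(3)] assms by blast+
  then show ?thesis by auto
qed

section \<open>Unit vectors and half sums as lattice points\<close>

lemma sum_unit_coord:
  assumes "a < (n::nat)"
  shows "(\<Sum>k<n. unit_coord a k * m k) = m a"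
proof -
  have "(\<Sum>k<n. unit_coord a k * m k) = (\<Sum>k<n. if k = a then m k else 0)"
    by (intro sum.cong) (auto simp: unit_coord_def)
  then show ?thesis using assms by simp
qed

lemma sum_half_pair:
  assumes "a < (n::nat)" "b < n"
  shows "(\<Sum>k<n. half_pair a b k * m k) = (m a + m b) / 2"
  using sum_unit_coord[OF assms(1), of m] sum_unit_coord[OF assms(2), of m]
  by (simp add: half_pair_def add_divide_distrib distrib_right sum.distrib flip: sum_divide_distrib)

lemma lat_unit_coord: "pm_mat M \<Longrightarrow> lat M (unit_coord a)"
  by (rule lat_of_Ints) (simp_all add: unit_coord_def)

lemma te_interlace_lat_half_pair:
  assumes "te_interlace M {..<n}" "M \<in> carrier_mat n d" "a < n" "b < n"
  shows "lat M (half_pair a b)"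
proof -
  have "dim_row M = n" "dim_col M = d" using assms(2) by auto
  then show ?thesis
    unfolding lat_def using te_interlace_half_sum[OF assms] by (simp only: sum_half_pair[OF assms(3,4)]) simp
qed

section \<open>A determinant of lattice points\<close>

lemma permutes_fixing_all_but_two:
  assumes p: "p permutes {0..<n}" and "\<And>a. a < n \<Longrightarrow> a \<noteq> i \<Longrightarrow> a \<noteq> j \<Longrightarrow> p a = a"
  shows "p = id \<or> p = Transposition.transpose i j"
proof -
  have "p permutes {i, j}"
    by (rule permutes_superset[OF p]) (use assms(2) in auto)
  then show ?thesis by (simp add: permutes_doubleton_iff)
qed

text \<open>The determinant, in the standard basis, of \<open>n\<close> elements of the lattice: \<open>c\<close>, \<open>c'\<close>, the unit
  vector \<open>h\<close> and the half sums of \<open>h\<close> with the other indices. Multiplied by a maximal minor it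
  is an integer, which bounds denominators in the lattice.\<close>

lemma te_interlace_two_coords:
  assumes inter: "te_interlace M {..<n}" and M: "M \<in> carrier_mat n d"
    and g: "g ` {..<n} \<subseteq> {..<d}"
    and ijh: "i < n" "j < n" "h < n" "i \<noteq> j" "i \<noteq> h" "j \<noteq> h"
    and c: "lat M c" "lat M c'"
  shows "(c i * c' j - c j * c' i) * (1/2) ^ (n - 3) * minor M n id g \<in> \<int>"
proof -
  have pm: "pm_mat M" using inter by (simp add: te_interlace_def te_set_def)
  define E where "E a = (if a = i then c else if a = j then c' else if a = h then unit_coord h else half_pair a h)" for a
  let ?E = "mat n n (\<lambda>(a, b). E a b)" and ?B = "mat n n (\<lambda>(a, b). M $$ (id a, g b))"
  have E: "?E \<in> carrier_mat n n" and B: "?B \<in> carrier_mat n n" by auto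
  have lat: "lat M (E a)" if "a < n" for a
    unfolding E_def using c lat_unit_coord[OF pm] te_interlace_lat_half_pair[OF inter M that ijh(3)] by auto
  \<comment> \<open>The entries of \<open>?E\<close> may be fractions, but its rows are lattice
    points, so the product with columns of \<open>M\<close> is integral.\<close>
  have "det (?E * ?B) \<in> \<int>"
  proof (rule det_Ints)
    fix a b assume ab: "a < n" "b < n"
    then have "(?E * ?B) $$ (a, b) = (\<Sum>k<n. E a k * M $$ (k, g b))"
      by (simp add: scalar_prod_def lessThan_atLeast0)
    then show "(?E * ?B) $$ (a, b) \<in> \<int>" using lat[OF ab(1)] ab(2) g M by (auto simp: lat_def)
  qed (use E B in auto)
  then have 1: "det ?E * minor M n id g \<in> \<int>" unfolding det_mult[OF E B] minor_def .
  let ?t = "Transposition.transpose i j"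
  let ?P = "\<lambda>p. \<Prod>a = 0..<n. ?E $$ (a, p a)"
  let ?rest = "{0..<n} - {i, j, h}"
  have split: "(\<Prod>a = 0..<n. F a) = F i * F j * F h * prod F ?rest" for F :: "nat \<Rightarrow> real"
  proof -
    have "{0..<n} = insert i (insert j (insert h ?rest))" using ijh by auto
    then have "(\<Prod>a = 0..<n. F a) = prod F (insert i (insert j (insert h ?rest)))" by simp
    also have "\<dots> = F i * F j * F h * prod F ?rest" using ijh by simp
    finally show ?thesis .
  qed
  have "card ?rest = n - 3" using ijh by (subst card_Diff_subset) auto
  then have rest: "(\<Prod>a\<in>?rest. E a a) = (1/2) ^ (n - 3)"
    by (subst prod.cong[where h = "\<lambda>_. 1/2" and B = ?rest])
      (auto simp: E_def half_pair_def unit_coord_def)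
  have id: "?P id = c i * c' j * (1/2) ^ (n - 3)"
  proof -
    have "?P id = (\<Prod>a = 0..<n. E a a)" by (intro prod.cong) auto
    then show ?thesis using split[of "\<lambda>a. E a a"] rest ijh by (simp add: E_def unit_coord_def)
  qed
  have tr: "?P ?t = c j * c' i * (1/2) ^ (n - 3)"
  proof -
    have "?P ?t = (\<Prod>a = 0..<n. E a (?t a))"
      using ijh by (intro prod.cong) (auto simp: Transposition.transpose_def)
    also have "\<dots> = E i j * E j i * E h h * (\<Prod>a\<in>?rest. E a (?t a))"
      using split[of "\<lambda>a. E a (?t a)"] ijh by (simp add: Transposition.transpose_def)
    also have "(\<Prod>a\<in>?rest. E a (?t a)) = (\<Prod>a\<in>?rest. E a a)"
      by (intro prod.cong) (auto simp: Transposition.transpose_def)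
    finally show ?thesis using rest ijh by (simp add: E_def unit_coord_def)
  qed
  \<comment> \<open>In the expansion only two permutations survive. Row \<open>h\<close> is a unit
    vector and forces \<open>p h = h\<close>; a row other than \<open>i\<close>, \<open>j\<close>,
    \<open>h\<close> has nonzero entries only at its own index and at \<open>h\<close>, which is
    taken. What remains free is whether \<open>i\<close> and \<open>j\<close> are swapped.\<close>
  have "det ?E = (\<Sum>p \<in> {p. p permutes {0..<n}}. signof p * ?P p)"
    by (rule det_def'[OF E])
  also have "\<dots> = (\<Sum>p \<in> {id, ?t}. signof p * ?P p)"
  proof (rule sum.mono_neutral_right)
    show "{id, ?t} \<subseteq> {p. p permutes {0..<n}}"
      using ijh permutes_swap_id[of i "{0..<n}" j] by (auto simp: permutes_id)
    show "\<forall>p\<in>{p. p permutes {0..<n}} - {id, ?t}. signof p * ?P p = 0"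
    proof (intro ballI, rule ccontr)
      fix p assume p: "p \<in> {p. p permutes {0..<n}} - {id, ?t}" "signof p * ?P p \<noteq> 0"
      then have perm: "p permutes {0..<n}" and inj: "inj p" by (auto simp: permutes_inj)
      have nz: "E a (p a) \<noteq> 0" if "a < n" for a
      proof -
        have "?E $$ (a, p a) \<noteq> 0" using p(2) that by auto
        moreover have "p a < n" using permutes_in_image[OF perm, of a] that by auto
        ultimately show ?thesis using that by simp
      qed
      have ph: "p h = h" using nz[OF ijh(3)] ijh by (auto simp: E_def unit_coord_def split: if_splits)
      have "p a = a" if a: "a < n" "a \<noteq> i" "a \<noteq> j" for a
      proof (cases "a = h")
        case False
        then have "p a = a \<or> p a = h"
          using nz[OF a(1)] a by (auto simp: E_def half_pair_def unit_coord_def split: if_splits)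
        moreover have "p a \<noteq> h" using inj ph False by (metis injD)
        ultimately show ?thesis by simp
      qed (use ph in simp)
      then show False using permutes_fixing_all_but_two[OF perm] p(1) by blast
    qed
  qed (simp add: finite_permutations)
  also have "\<dots> = ?P id - ?P ?t"
  proof -
    have "id \<noteq> ?t" using ijh(4) by (metis id_apply transpose_apply_first)
    then show ?thesis using ijh(4) by (simp add: sign_swap_id)
  qed
  finally have "det ?E = (c i * c' j - c j * c' i) * (1/2) ^ (n - 3)"
    using id tr by (simp add: algebra_simps)
  then show ?thesis using 1 by simp
qed

text \<open>With the half sum of two units \<open>j\<close> and \<open>h\<close> other than
  \<open>i\<close> as second lattice point, the 2 x 2 determinant reduces to \<open>c i / 2\<close>.
  This takes three distinct rows.\<close>

lemma te_interlace_coord: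
  assumes inter: "te_interlace M {..<n}" and M: "M \<in> carrier_mat n d" and n: "3 \<le> n"
    and g: "g ` {..<n} \<subseteq> {..<d}" and c: "lat M c" and i: "i < n"
  shows "c i * (1/2) ^ (n - 2) * minor M n id g \<in> \<int>"
proof -
  have "\<exists>j h. j < n \<and> h < n \<and> j \<noteq> i \<and> h \<noteq> i \<and> j \<noteq> h"
  proof (cases "i = 0")
    case True
    then show ?thesis using n by (intro exI[of _ 1] exI[of _ 2]) auto
  next
    case False
    then show ?thesis using n i by (intro exI[of _ 0] exI[of _ "if i = 1 then 2 else 1"]) auto
  qed
  then obtain j h where jh: "j < n" "h < n" "j \<noteq> i" "h \<noteq> i" "j \<noteq> h" by blast
  have "(c i * half_pair j h j - c j * half_pair j h i) * (1/2) ^ (n - 3) * minor M n id g \<in> \<int>"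
    using te_interlace_two_coords[OF inter M g i jh(1,2) _ _ _ c te_interlace_lat_half_pair[OF inter M jh(1,2)]] jh
    by auto
  moreover have "n - 2 = Suc (n - 3)" using n by simp
  ultimately show ?thesis using jh by (simp add: half_pair_def unit_coord_def)
qed

lemma equidet_full_minor:
  assumes "equidet M {..<n} D" "M \<in> carrier_mat n d"
  obtains g where "inj_on g {..<n}" "g ` {..<n} \<subseteq> {..<d}" "\<bar>minor M n id g\<bar> = D" "minor M n id g \<noteq> 0"
proof -
  obtain J where J: "J \<subseteq> {..<dim_col M}" "card J = n" "det (submatrix M {..<n} J) \<noteq> 0"
    "\<bar>det (submatrix M {..<n} J)\<bar> = D"
    using assms by (auto simp: equidet_def)
  have g: "bij_betw (pick J) {..<n} J" using pick_enum[of J] J finite_subset by auto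
  have "\<bar>det (submatrix M {..<n} J)\<bar> = \<bar>minor M n id (pick J)\<bar>"
    by (rule det_submatrix_minor[OF _ g _ J(1)]) (use assms(2) in auto)
  then show ?thesis using that[of "pick J"] g J assms(2) by (auto simp: bij_betw_def)
qed

section \<open>Unit vectors and half sums among the nonnegative lattice points\<close>

definition short_coords :: "nat \<Rightarrow> (nat \<Rightarrow> real) set" where
  "short_coords n = unit_coord ` {..<n} \<union> {half_pair a b | a b. a < b \<and> b < n}"

text \<open>With at most one row, every square submatrix has order 0 or 1 and determinant -1, 0 or
  1, so the matrix would be totally unimodular.\<close>

lemma te_interlace_ge_2:
  assumes inter: "te_interlace M {..<n}" and M: "M \<in> carrier_mat n d"
  shows "2 \<le> n"
proof (rule ccontr)
  assume n: "\<not> 2 \<le> n"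
  have pm: "pm_mat M" and "\<not> tu_mat M"
    using inter rowsub_all[OF M] by (auto simp: te_interlace_def te_set_def tu_set_def)
  then obtain R J where RJ: "R \<subseteq> {..<dim_row M}" "J \<subseteq> {..<dim_col M}" "card R = card J"
    "det (submatrix M R J) \<notin> {-1, 0, 1}"
    by (auto simp: tu_mat_def)
  have enum: "bij_betw (pick R) {..<card R} R" "bij_betw (pick J) {..<card R} J"
    using pick_enum[of R] pick_enum[of J] RJ finite_subset by auto
  have "card R \<le> 1" using card_mono[OF _ RJ(1)] M n by simp
  then have "minor M (card R) (pick R) (pick J) \<in> {-1, 0, 1}"
    using enum RJ by (intro minor_le_1 pm) (auto simp: bij_betw_def)
  then show False
    using RJ(4) det_submatrix_minor[OF enum RJ(1,2)] by (auto simp: abs_if split: if_splits)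
qed

lemma te_interlace_nonzero_column:
  assumes inter: "te_interlace M {..<n}" and M: "M \<in> carrier_mat n d"
  obtains j where "j < d" "\<And>i. i < n \<Longrightarrow> M $$ (i, j) = 1 \<or> M $$ (i, j) = -1"
proof -
  have ind: "rows_indep M {..<n}" using inter by (simp add: te_interlace_def te_set_def)
  have "0 < n" using te_interlace_ge_2[OF assms] by simp
  then have "\<exists>j<d. (\<Sum>i<n. M $$ (i, j)) \<noteq> 0"
    using ind[unfolded rows_indep_def, THEN spec[of _ "\<lambda>_. 1"]] M by auto
  then obtain j where j: "j < d" "(\<Sum>i<n. M $$ (i, j)) \<noteq> 0" by auto
  then obtain i where "i < n" "M $$ (i, j) \<noteq> 0" by (metis lessThan_iff sum.neutral)
  then show ?thesis using that[OF j(1)] te_interlace_entry[OF inter M _ j(1)] by blast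
qed

text \<open>A nonzero column has no zero entry, so its product with \<open>u\<close> is
  \<open>u a\<close> up to sign.\<close>

lemma te_interlace_single_coord_Ints:
  assumes inter: "te_interlace M {..<n}" and M: "M \<in> carrier_mat n d"
    and u: "lat M u" and a: "a < n" and 0: "\<And>k. k < n \<Longrightarrow> k \<noteq> a \<Longrightarrow> u k = 0"
  shows "u a \<in> \<int>"
proof -
  obtain j where j: "j < d" "\<And>i. i < n \<Longrightarrow> M $$ (i, j) = 1 \<or> M $$ (i, j) = -1"
    using te_interlace_nonzero_column[OF inter M] by metis
  have "(\<Sum>k<n. u k * M $$ (k, j)) = (\<Sum>k\<in>{a}. u k * M $$ (k, j))"
    using a 0 by (intro sum.mono_neutral_right) auto
  then have "u a * M $$ (a, j) \<in> \<int>" using u M j(1) by (auto simp: lat_def)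
  then show ?thesis using j(2)[OF a] by auto
qed

text \<open>If no coordinate reaches 1, the nonzero ones equal 1/2. A single one would be integral
  by the preceding lemma, so there are two, and their half sum lies below \<open>c\<close>.\<close>

lemma te_interlace_short_below:
  assumes inter: "te_interlace M {..<n}" and M: "M \<in> carrier_mat n d"
    and c: "lat M c" "\<And>i. i < n \<Longrightarrow> 0 \<le> c i" "\<exists>i<n. c i \<noteq> 0" "\<And>i. i < n \<Longrightarrow> 2 * c i \<in> \<int>"
  shows "\<exists>k\<in>short_coords n. \<forall>i<n. k i \<le> c i"
proof (cases "\<exists>a<n. 1 \<le> c a")
  case True
  then obtain a where "a < n" "1 \<le> c a" by blast
  then show ?thesis
    using c(2) by (intro bexI[of _ "unit_coord a"]) (auto simp: unit_coord_def short_coords_def)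
next
  case False
  have half: "c i = 1/2" if i: "i < n" "c i \<noteq> 0" for i
  proof -
    obtain z where z: "2 * c i = of_int z" using c(4)[OF i(1)] by (rule Ints_cases)
    moreover have "0 < 2 * c i" "2 * c i < 2" using c(2) i False by force+
    ultimately have "0 < z" "z < 2" by linarith+
    then show ?thesis using z by simp
  qed
  obtain a where a: "a < n" "c a \<noteq> 0" using c(3) by blast
  have "\<exists>b<n. b \<noteq> a \<and> c b \<noteq> 0"
  proof (rule ccontr)
    assume "\<not> ?thesis"
    then have "c a \<in> \<int>" using te_interlace_single_coord_Ints[OF inter M c(1) a(1)] by blast
    then show False using half[OF a] by (auto elim!: Ints_cases)
  qed
  then obtain b where b: "b < n" "b \<noteq> a" "c b \<noteq> 0" by blast
  have "min a b < max a b" "max a b < n" using a(1) b(1,2) by auto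
  then have "half_pair (min a b) (max a b) \<in> short_coords n"
    unfolding short_coords_def by blast
  moreover have "\<forall>i<n. half_pair (min a b) (max a b) i \<le> c i"
    using half[OF a] half[OF b(1,3)] b(2) c(2)
    by (auto simp: half_pair_def unit_coord_def min_def max_def)
  ultimately show ?thesis by blast
qed

text \<open>Below a half sum the two coordinates are 0 or 1/2; if they differed, 1/2 would be the
  only nonzero coordinate of a lattice point. That \<open>u\<close> has half-integral coordinates is
  a hypothesis because the thin and the thick case obtain it in different ways.\<close>

lemma te_interlace_short_irreducible:
  assumes inter: "te_interlace M {..<n}" and M: "M \<in> carrier_mat n d"
    and k: "k \<in> short_coords n" and u: "lat M u" "\<And>i. i < n \<Longrightarrow> 0 \<le> u i \<and> u i \<le> k i"
    and half: "\<And>i. i < n \<Longrightarrow> 2 * u i \<in> \<int>"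
  shows "(\<forall>i<n. u i = 0) \<or> (\<forall>i<n. u i = k i)"
proof -
  consider a where "a < n" "k = unit_coord a" | a b where "a < b" "b < n" "k = half_pair a b"
    using k by (auto simp: short_coords_def)
  then show ?thesis
  proof cases
    case 1
    then have 0: "u i = 0" if "i < n" "i \<noteq> a" for i
      using u(2)[OF that(1)] that by (simp add: unit_coord_def)
    have "u a \<in> \<int>" by (rule te_interlace_single_coord_Ints[OF inter M u(1) 1(1) 0])
    then obtain z where "u a = of_int z" by (rule Ints_cases)
    moreover have "0 \<le> u a" "u a \<le> 1" using u(2)[OF 1(1)] 1 by (auto simp: unit_coord_def)
    ultimately have "u a = 0 \<or> u a = 1" by auto
    then show ?thesis using 0 1 by (auto simp: unit_coord_def)
  next
    case 2
    then have an: "a < n" by simp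
    have 0: "u i = 0" if "i < n" "i \<noteq> a" "i \<noteq> b" for i
      using u(2)[OF that(1)] that 2 by (simp add: half_pair_def unit_coord_def)
    have dich: "u i = 0 \<or> u i = 1/2" if i: "i < n" "i = a \<or> i = b" for i
    proof -
      obtain z where z: "2 * u i = of_int z" using half[OF i(1)] by (rule Ints_cases)
      moreover have "0 \<le> 2 * u i" "2 * u i \<le> 1"
        using u(2)[OF i(1)] i 2 by (auto simp: half_pair_def unit_coord_def)
      ultimately have "z = 0 \<or> z = 1" by linarith
      then show ?thesis using z by auto
    qed
    have nonint: "(1/2 :: real) \<notin> \<int>" by (auto elim!: Ints_cases)
    have "u a = u b"
    proof (rule ccontr)
      assume "u a \<noteq> u b"
      then consider "u a = 0" "u b = 1/2" | "u a = 1/2" "u b = 0"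
        using dich[OF an] dich[OF 2(2)] by argo
      then show False
      proof cases
        case 1
        have "u k = 0" if "k < n" "k \<noteq> b" for k
          using 0[OF that(1) _ that(2)] 1(1) by (cases "k = a") auto
        then have "u b \<in> \<int>"
          by (rule te_interlace_single_coord_Ints[OF inter M u(1) \<open>b < n\<close>])
        then show False using 1 nonint by simp
      next
        case 2
        have "u k = 0" if "k < n" "k \<noteq> a" for k
          using 0[OF that] 2(2) by (cases "k = b") auto
        then have "u a \<in> \<int>"
          by (rule te_interlace_single_coord_Ints[OF inter M u(1) an])
        then show False using 2 nonint by simp
      qed
    qed
    then have eq: "u i = (if i = a \<or> i = b then u a else 0)" if "i < n" for i
      using 0[OF that] by auto
    have "u a = 0 \<or> u a = 1/2" using dich[OF an] by simp
    then show ?thesis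
    proof (elim disjE)
      assume "u a = 0"
      then have "u i = 0" if "i < n" for i using eq[OF that] by simp
      then show ?thesis by blast
    next
      assume "u a = 1/2"
      then have "u i = k i" if "i < n" for i
        using eq[OF that] 2 by (simp add: half_pair_def unit_coord_def)
      then show ?thesis by blast
    qed
  qed
qed

text \<open>Cancelling 2^(n-2) in \<open>te_interlace_coord\<close> against the equideterminant
  2^(n-1) leaves the factor 2.\<close>

lemma thin_te_interlace_half_Ints:
  assumes thin: "thin_te_interlace M {..<n}" and M: "M \<in> carrier_mat n d" and n: "3 \<le> n"
    and c: "lat M c" and i: "i < n"
  shows "2 * c i \<in> \<int>"
proof -
  have inter: "te_interlace M {..<n}" and eq: "equidet M {..<n} (2 ^ (n - 1))"
    using thin by (auto simp: thin_te_interlace_def)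
  obtain g where g: "g ` {..<n} \<subseteq> {..<d}" "\<bar>minor M n id g\<bar> = 2 ^ (n - 1)"
    using equidet_full_minor[OF eq M] by metis
  have "\<bar>c i * (1/2) ^ (n - 2) * minor M n id g\<bar> \<in> \<int>"
    using te_interlace_coord[OF inter M n g(1) c i] by (rule Ints_abs)
  moreover have "n - 1 = Suc (n - 2)" using n by simp
  then have "\<bar>c i * (1/2) ^ (n - 2) * minor M n id g\<bar> = \<bar>2 * c i\<bar>"
    unfolding abs_mult g(2) by (simp add: power_one_over)
  ultimately have "\<bar>2 * c i\<bar> \<in> \<int>" by metis
  then show ?thesis unfolding abs_if by (metis Ints_minus minus_minus)
qed

text \<open>Translates membership in \<int>/2 into the parity of a numerator over 4. A coordinate is
  called odd below when this numerator is odd.\<close>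

lemma quarter_half_Ints_iff:
  assumes "4 * x = real_of_int a"
  shows "2 * x \<in> \<int> \<longleftrightarrow> even a"
proof
  assume "2 * x \<in> \<int>"
  then obtain z where "2 * x = of_int z" by (rule Ints_cases)
  then have "real_of_int a = of_int (2 * z)" using assms by simp
  then show "even a" by (metis dvd_triv_left of_int_eq_iff)
next
  assume "even a"
  then obtain z where "a = 2 * z" by (rule evenE)
  then have "2 * x = of_int z" using assms by simp
  then show "2 * x \<in> \<int>" by simp
qed

section \<open>Thick te-interlaces\<close>

text \<open>A 2 x 2 minor with entries -1, 0, 1 has absolute value at most 2, but thickness of a
  pair would ask for 4.\<close>

lemma thick_te_interlace_ge_3:
  assumes thick: "thick_te_interlace M {..<n}" and M: "M \<in> carrier_mat n d"
  shows "3 \<le> n"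
proof (rule ccontr)
  assume "\<not> 3 \<le> n"
  have inter: "te_interlace M {..<n}" and eq: "equidet M {..<n} (2 ^ n)"
    using thick by (auto simp: thick_te_interlace_def)
  have n: "n = 2" using te_interlace_ge_2[OF inter M] \<open>\<not> 3 \<le> n\<close> by simp
  obtain g where g: "g ` {..<n} \<subseteq> {..<d}" "\<bar>minor M n id g\<bar> = 2 ^ n"
    using equidet_full_minor[OF eq M] by metis
  have "g 0 < d" "g 1 < d" using g(1) n by (auto simp: image_subset_iff)
  moreover have "\<bar>M $$ (a, b)\<bar> \<le> 1" if "a < n" "b < d" for a b
  proof -
    have "M $$ (a, b) \<in> {-1, 0, 1}"
      using inter M that unfolding te_interlace_def te_set_def pm_mat_def by (metis carrier_matD)
    then show ?thesis by auto
  qed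
  ultimately have "\<bar>M $$ (0, g 0)\<bar> * \<bar>M $$ (1, g 1)\<bar> \<le> 1 * 1" "\<bar>M $$ (0, g 1)\<bar> * \<bar>M $$ (1, g 0)\<bar> \<le> 1 * 1"
    using n by - (rule mult_mono; simp)+
  moreover have "\<bar>minor M n id g\<bar> \<le> \<bar>M $$ (0, g 0) * M $$ (1, g 1)\<bar> + \<bar>M $$ (0, g 1) * M $$ (1, g 0)\<bar>"
    unfolding n minor_2 by (simp add: abs_triangle_ineq4)
  ultimately show False using g(2) n by (simp add: abs_mult)
qed

lemma thick_te_interlace_quarter_Ints:
  assumes thick: "thick_te_interlace M {..<n}" and M: "M \<in> carrier_mat n d"
    and c: "lat M c" and i: "i < n"
  shows "4 * c i \<in> \<int>"
proof -
  have inter: "te_interlace M {..<n}" and eq: "equidet M {..<n} (2 ^ n)"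
    using thick by (auto simp: thick_te_interlace_def)
  note n = thick_te_interlace_ge_3[OF thick M]
  obtain g where g: "g ` {..<n} \<subseteq> {..<d}" "\<bar>minor M n id g\<bar> = 2 ^ n"
    using equidet_full_minor[OF eq M] by metis
  have "\<bar>c i * (1/2) ^ (n - 2) * minor M n id g\<bar> \<in> \<int>"
    using te_interlace_coord[OF inter M n g(1) c i] by (rule Ints_abs)
  moreover have "(2::real) ^ n = 2 ^ (n - 2) * 4"
    using n by (auto simp: power_add dest!: le_Suc_ex)
  then have "\<bar>c i * (1/2) ^ (n - 2) * minor M n id g\<bar> = \<bar>4 * c i\<bar>"
    unfolding abs_mult g(2) by (simp add: power_one_over)
  ultimately have "\<bar>4 * c i\<bar> \<in> \<int>" by metis
  then show ?thesis unfolding abs_if by (metis Ints_minus minus_minus)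
qed

text \<open>The determinant argument makes \<open>8 * (c i * c' j - c j * c' i)\<close> an integer.
  If \<open>2 * c j\<close> were an integer, the second product would be integral after
  multiplication by 8, hence also the first one; then the product of the numerators of
  \<open>c i\<close> and \<open>c' j\<close> over 4 would be even, but both are odd.\<close>

lemma thick_te_interlace_same_odd_coords:
  assumes thick: "thick_te_interlace M {..<n}" and M: "M \<in> carrier_mat n d"
    and c: "lat M c" "lat M c'" and ij: "i < n" "j < n"
    and odd: "2 * c i \<notin> \<int>" "2 * c' j \<notin> \<int>"
  shows "2 * c j \<notin> \<int>"
proof
  assume j2: "2 * c j \<in> \<int>"
  have "i \<noteq> j" using j2 odd(1) by auto
  have inter: "te_interlace M {..<n}" and eq: "equidet M {..<n} (2 ^ n)"
    using thick by (auto simp: thick_te_interlace_def)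
  note n = thick_te_interlace_ge_3[OF thick M]
  obtain g where g: "g ` {..<n} \<subseteq> {..<d}" "\<bar>minor M n id g\<bar> = 2 ^ n"
    using equidet_full_minor[OF eq M] by metis
  have "{..<n} - {i, j} \<noteq> {}"
  proof
    assume "{..<n} - {i, j} = {}"
    then have "card {..<n} \<le> card {i, j}" by (intro card_mono) auto
    then show False using n \<open>i \<noteq> j\<close> by simp
  qed
  then obtain h where h: "h < n" "i \<noteq> h" "j \<noteq> h" by blast
  have "\<bar>(c i * c' j - c j * c' i) * (1/2) ^ (n - 3) * minor M n id g\<bar> \<in> \<int>"
    using te_interlace_two_coords[OF inter M g(1) ij h(1) \<open>i \<noteq> j\<close> h(2,3) c] by (rule Ints_abs)
  moreover have "(2::real) ^ n = 2 ^ (n - 3) * 8"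
    using n by (auto simp: power_add dest!: le_Suc_ex)
  then have "\<bar>(c i * c' j - c j * c' i) * (1/2) ^ (n - 3) * minor M n id g\<bar> = \<bar>8 * (c i * c' j - c j * c' i)\<bar>"
    unfolding abs_mult g(2) by (simp add: power_one_over)
  ultimately have "\<bar>8 * (c i * c' j - c j * c' i)\<bar> \<in> \<int>" by metis
  then have "8 * (c i * c' j - c j * c' i) \<in> \<int>"
    unfolding abs_if by (metis Ints_minus minus_minus)
  moreover have "(2 * c j) * (4 * c' i) \<in> \<int>"
    using j2 thick_te_interlace_quarter_Ints[OF thick M c(2) ij(1)] by (rule Ints_mult)
  ultimately have "8 * (c i * c' j - c j * c' i) + (2 * c j) * (4 * c' i) \<in> \<int>" by (rule Ints_add)
  then have "8 * (c i * c' j) \<in> \<int>" by (simp add: algebra_simps)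
  then obtain z where z: "8 * (c i * c' j) = of_int z" by (rule Ints_cases)
  obtain a where a: "4 * c i = of_int a"
    using thick_te_interlace_quarter_Ints[OF thick M c(1) ij(1)] by (rule Ints_cases)
  obtain b where b: "4 * c' j = of_int b"
    using thick_te_interlace_quarter_Ints[OF thick M c(2) ij(2)] by (rule Ints_cases)
  have "(4 * c i) * (4 * c' j) = 2 * (8 * (c i * c' j))" by simp
  then have "of_int (a * b) = (of_int (2 * z) :: real)" unfolding a b z by simp
  then have "even (a * b)" by (metis dvd_triv_left of_int_eq_iff)
  then show False
    using odd quarter_half_Ints_iff[OF a] quarter_half_Ints_iff[OF b] by simp
qed

text \<open>Row \<open>l\<close> of the inverse becomes a lattice point of the full matrix when
  extended by zero outside \<open>R\<close>: its product with any column of \<open>M\<close> is the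
  value controlled by \<open>te_binv_column\<close>.\<close>

lemma te_binv_row_lat:
  assumes te: "te_mat M" and ind: "rows_indep M R" and R: "R \<subseteq> {..<dim_row M}"
    and f: "bij_betw f {..<r} R"
    and g: "inj_on g {..<r}" "g ` {..<r} \<subseteq> {..<dim_col M}" "minor M r f g \<noteq> 0"
    and l: "l < r"
  obtains c where "lat M c" "\<And>i. i < dim_row M \<Longrightarrow> i \<notin> R \<Longrightarrow> c i = 0" "\<And>s. s < r \<Longrightarrow> c (f s) = binv M r f g l s"
proof -
  define c where "c i = (if i \<in> R then binv M r f g l (inv_into {..<r} f i) else 0)" for i
  have cf: "c (f s) = binv M r f g l s" if "s < r" for s
    using f that by (auto simp: c_def bij_betw_def)
  have c0: "c i = 0" if "i < dim_row M" "i \<notin> R" for i using that by (simp add: c_def)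
  have "(\<Sum>i<dim_row M. c i * M $$ (i, j)) \<in> \<int>" if j: "j < dim_col M" for j
  proof -
    have "(\<Sum>i<dim_row M. c i * M $$ (i, j)) = (\<Sum>s<r. c (f s) * M $$ (f s, j))"
      by (rule sum_supported[OF f R c0])
    also have "\<dots> = (\<Sum>s<r. binv M r f g l s * M $$ (f s, j))"
      using cf by (intro sum.cong) auto
    also have "\<dots> \<in> \<int>" using te_binv_column[OF te ind R f g l j] by auto
    finally show ?thesis .
  qed
  then have "lat M c" by (simp add: lat_def)
  then show ?thesis using that c0 cf by blast
qed

text \<open>If every coordinate were a half-integer, twice the inverse of a nonsingular maximal square
  submatrix \<open>B\<close> would be an integer matrix of determinant \<open>\<plusminus>1\<close>, so \<open>B / 2\<close> would be integral.\<close>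

lemma thick_te_interlace_exists_odd:
  assumes thick: "thick_te_interlace M {..<n}" and M: "M \<in> carrier_mat n d"
  obtains c i where "lat M c" "i < n" "2 * c i \<notin> \<int>"
proof (rule ccontr)
  note * = that
  assume "\<not> thesis"
  then have half: "2 * c i \<in> \<int>" if "lat M c" "i < n" for c i using that * by blast
  have inter: "te_interlace M {..<n}" and eq: "equidet M {..<n} (2 ^ n)"
    using thick by (auto simp: thick_te_interlace_def)
  have te: "te_mat M" and ind: "rows_indep M {..<n}"
    using inter te_set_te_mat[OF M] by (auto simp: te_interlace_def te_set_def)
  have n0: "0 < n" using thick_te_interlace_ge_3[OF thick M] by simp
  obtain g where g: "inj_on g {..<n}" "g ` {..<n} \<subseteq> {..<d}" "\<bar>minor M n id g\<bar> = 2 ^ n" "minor M n id g \<noteq> 0"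
    using equidet_full_minor[OF eq M] .
  have idn: "bij_betw id {..<n} {..<n}" and nR: "{..<n} \<subseteq> {..<dim_row M}"
    and gd: "g ` {..<n} \<subseteq> {..<dim_col M}" using M g(2) by auto
  define N where "N = binv M n id g"
  have N: "2 * N l s \<in> \<int>" if l: "l < n" and s: "s < n" for l s
  proof -
    obtain c where "lat M c" "\<And>s. s < n \<Longrightarrow> c (id s) = N l s"
      using te_binv_row_lat[OF te ind nR idn g(1) gd g(4) l] unfolding N_def by metis
    then show ?thesis using half[of c s] s by simp
  qed
  let ?X = "mat n n (\<lambda>(l, s). 2 * N l s)" and ?B = "mat n n (\<lambda>(a, b). M $$ (id a, g b))"
  have X: "?X \<in> carrier_mat n n" and B: "?B \<in> carrier_mat n n" by auto
  note adj = adj_mat(1,3)[OF X]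
  have XB: "?X * ?B = 2 \<cdot>\<^sub>m 1\<^sub>m n"
  proof (intro eq_matI)
    fix a b assume "a < dim_row (2 \<cdot>\<^sub>m 1\<^sub>m n :: real mat)" "b < dim_col (2 \<cdot>\<^sub>m 1\<^sub>m n :: real mat)"
    then have ab: "a < n" "b < n" by auto
    have "(?X * ?B) $$ (a, b) = (\<Sum>s<n. 2 * (N a s * M $$ (id s, g b)))"
      using ab by (simp add: scalar_prod_def lessThan_atLeast0 mult.assoc)
    also have "\<dots> = 2 * (if a = b then 1 else 0)"
      unfolding sum_distrib_left[symmetric] N_def binv_left[OF g(4) ab] ..
    finally show "(?X * ?B) $$ (a, b) = (2 \<cdot>\<^sub>m 1\<^sub>m n) $$ (a, b)" using ab by simp
  qed auto
  have "det ?X * minor M n id g = 2 ^ n"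
    using arg_cong[OF XB, of det] unfolding det_mult[OF X B] minor_def by simp
  then have "\<bar>det ?X * minor M n id g\<bar> = \<bar>2 ^ n\<bar>" by (rule arg_cong)
  then have "\<bar>det ?X\<bar> * 2 ^ n = 2 ^ n" unfolding abs_mult g(3) by simp
  then have detX: "\<bar>det ?X\<bar> = 1" by simp
  \<comment> \<open>Cancelling \<open>?X\<close> by its adjugate gives \<open>det ?X\<close> times
    \<open>B\<close> as twice an integral matrix. Since \<open>det ?X\<close> is 1 or -1, all
    entries of \<open>B\<close> would be even, in contrast to the entry at (0, 0).\<close>
  have "(adj_mat ?X * ?X) * ?B = adj_mat ?X * (?X * ?B)"
    by (rule assoc_mult_mat[OF adj(1) X B])
  then have "det ?X \<cdot>\<^sub>m ?B = 2 \<cdot>\<^sub>m adj_mat ?X"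
    unfolding adj(2) XB mult_smult_assoc_mat[OF one_carrier_mat B]
      mult_smult_distrib[OF adj(1) one_carrier_mat] left_mult_one_mat[OF B] right_mult_one_mat[OF adj(1)] .
  then have "(det ?X \<cdot>\<^sub>m ?B) $$ (0, 0) = (2 \<cdot>\<^sub>m adj_mat ?X) $$ (0, 0)" by (rule arg_cong)
  then have 00: "det ?X * M $$ (0, g 0) = 2 * adj_mat ?X $$ (0, 0)"
    using n0 adj(1) by simp
  have "\<exists>s<n. M $$ (s, g 0) \<noteq> 0"
  proof (rule ccontr)
    assume "\<not> ?thesis"
    then have "(\<Sum>s<n. N 0 s * M $$ (id s, g 0)) = 0" by (intro sum.neutral) auto
    then show False using binv_left[OF g(4) n0 n0] by (simp add: N_def)
  qed
  then have "M $$ (0, g 0) = 1 \<or> M $$ (0, g 0) = -1"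
    using te_interlace_entry[OF inter M n0] g(2) n0 by blast
  then have "\<bar>det ?X * M $$ (0, g 0)\<bar> = 1" using detX by (auto simp: abs_mult)
  then have "\<bar>2 * adj_mat ?X $$ (0, 0)\<bar> = 1" using 00 by metis
  moreover have "adj_mat ?X $$ (0, 0) \<in> \<int>"
  proof -
    have "det (mat_delete ?X 0 0) \<in> \<int>"
    proof (rule det_Ints)
      show "mat_delete ?X 0 0 \<in> carrier_mat (n - 1) (n - 1)" using mat_delete_carrier[OF X] .
    qed (use N in \<open>auto simp: mat_delete_def\<close>)
    then show ?thesis using n0 by (simp add: adj_mat_def cofactor_def)
  qed
  then obtain z where "adj_mat ?X $$ (0, 0) = of_int z" by (rule Ints_cases)
  ultimately have "\<bar>2 * real_of_int z\<bar> = 1" by metis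
  then have "real_of_int \<bar>2 * z\<bar> = real_of_int 1"
    by (simp only: of_int_abs of_int_mult of_int_numeral of_int_1)
  then have "\<bar>2 * z\<bar> = 1" by (rule of_int_eq_iff[THEN iffD1])
  then show False by presburger
qed

text \<open>After multiplication by 4, the numerators with signs add up to a multiple of 4. Signs do
  not change parity, so the number of odd numerators is even.\<close>

lemma even_card_of_odd_quarters:
  fixes x :: "'a \<Rightarrow> real"
  assumes fin: "finite A" and x: "\<And>a. a \<in> A \<Longrightarrow> 4 * x a \<in> \<int>"
    and m: "\<And>a. a \<in> A \<Longrightarrow> m a = 1 \<or> m a = -1" and sum: "(\<Sum>a\<in>A. x a * m a) \<in> \<int>"
  shows "even (card {a\<in>A. 2 * x a \<notin> \<int>})"
proof -
  have "\<exists>y. \<forall>a\<in>A. 4 * x a = real_of_int (y a)"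
    using x by (intro bchoice) (auto elim!: Ints_cases)
  then obtain y where y: "\<And>a. a \<in> A \<Longrightarrow> 4 * x a = real_of_int (y a)" by blast
  define s where "s a = (if m a = 1 then 1 else - 1 :: int)" for a
  have s: "m a = real_of_int (s a)" "odd (s a)" if "a \<in> A" for a
    using m[OF that] by (auto simp: s_def)
  obtain z where z: "(\<Sum>a\<in>A. x a * m a) = of_int z" using sum by (rule Ints_cases)
  have "real_of_int (\<Sum>a\<in>A. y a * s a) = (\<Sum>a\<in>A. 4 * (x a * m a))"
    unfolding of_int_sum by (intro sum.cong) (use y s in \<open>auto simp: algebra_simps\<close>)
  also have "\<dots> = of_int (4 * z)" using z by (simp flip: sum_distrib_left)
  finally have "(\<Sum>a\<in>A. y a * s a) = 4 * z" by (rule of_int_eq_iff[THEN iffD1])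
  then have "even (\<Sum>a\<in>A. y a * s a)" by simp
  then have "even (card {a\<in>A. odd (y a * s a)})" by (rule even_sum_iff[OF fin, THEN iffD1])
  moreover have "{a\<in>A. odd (y a * s a)} = {a\<in>A. 2 * x a \<notin> \<int>}"
    using s(2) quarter_half_Ints_iff[OF y] by auto
  ultimately show ?thesis by simp
qed

text \<open>If \<open>W\<close>, the set of coordinates outside \<open>\<int> / 2\<close>, is proper, add one row to it: equimodularity
  forces every row of the inverse of a nonsingular maximal square submatrix of these rows to have
  exactly \<open>W\<close> as its set of coordinates outside \<open>\<int> / 2\<close>, so both \<open>W\<close> and \<open>W\<close> with the extra row have
  an even number of elements.\<close>

lemma thick_te_interlace_all_odd:
  assumes thick: "thick_te_interlace M {..<n}" and M: "M \<in> carrier_mat n d"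
    and c: "lat M c" and s: "s < n" "2 * c s \<notin> \<int>" and i: "i < n"
  shows "2 * c i \<notin> \<int>"
proof
  assume ci: "2 * c i \<in> \<int>"
  have inter: "te_interlace M {..<n}" using thick by (simp add: thick_te_interlace_def)
  have te: "te_mat M" and indn: "rows_indep M {..<n}"
    using inter te_set_te_mat[OF M] by (auto simp: te_interlace_def te_set_def)
  note quarter = thick_te_interlace_quarter_Ints[OF thick M]
  note same = thick_te_interlace_same_odd_coords[OF thick M]
  define W where "W = {k \<in> {..<n}. 2 * c k \<notin> \<int>}"
  have W: "s \<in> W" "i \<notin> W" "W \<subseteq> {..<n}" "finite W" using s ci by (auto simp: W_def)
  obtain j0 where j0: "j0 < d" "\<And>i. i < n \<Longrightarrow> M $$ (i, j0) = 1 \<or> M $$ (i, j0) = -1"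
    using te_interlace_nonzero_column[OF inter M] by metis
  have "(\<Sum>k<n. c k * M $$ (k, j0)) \<in> \<int>" using c M j0(1) by (auto simp: lat_def)
  then have evenW: "even (card W)"
    unfolding W_def by (intro even_card_of_odd_quarters[where m = "\<lambda>k. M $$ (k, j0)"])
      (use j0(2) quarter[OF c] in auto)
  \<comment> \<open>For each \<open>a\<close> outside \<open>W\<close>, subtract
    \<open>2 * c a\<close> times the half sum of the units \<open>a\<close> and \<open>s\<close>:
    this clears coordinate \<open>a\<close> and moves \<open>c a\<close> to coordinate
    \<open>s\<close>. The result is supported on \<open>W\<close>, so that the inverse on the rows
    \<open>R\<close> expresses it, and it stays odd at \<open>s\<close> because the numbers
    \<open>2 * c a\<close> are integers.\<close>
  define c' where "c' k = (if k \<in> W then c k else 0) - (if k = s then (\<Sum>a\<in>{..<n} - W. c a) else 0)" for k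
  have c'_lat: "lat M c'"
    unfolding lat_def
  proof (intro allI impI)
    fix j assume "j < dim_col M"
    then have j: "j < d" using M by simp
    let ?V = "{..<n} - W"
    have V: "(\<Sum>a\<in>?V. (2 * c a) * ((M $$ (a, j) + M $$ (s, j)) / 2))
        = (\<Sum>a\<in>?V. c a * M $$ (a, j)) + (\<Sum>a\<in>?V. c a) * M $$ (s, j)"
    proof -
      have "(2 * c a) * ((M $$ (a, j) + M $$ (s, j)) / 2) = c a * M $$ (a, j) + c a * M $$ (s, j)" for a
        by (simp add: distrib_left)
      then show ?thesis by (simp only: sum.distrib sum_distrib_right)
    qed
    have "(\<Sum>k<n. c' k * M $$ (k, j))
        = (\<Sum>k<n. (if k \<in> W then c k * M $$ (k, j) else 0) - (if k = s then (\<Sum>a\<in>?V. c a) * M $$ (k, j) else 0))"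
      by (intro sum.cong) (auto simp: c'_def algebra_simps)
    also have "\<dots> = (\<Sum>k<n. if k \<in> W then c k * M $$ (k, j) else 0) - (\<Sum>a\<in>?V. c a) * M $$ (s, j)"
      using s(1) by (simp add: sum_subtractf)
    also have "(\<Sum>k<n. if k \<in> W then c k * M $$ (k, j) else 0) = (\<Sum>k\<in>W. c k * M $$ (k, j))"
      using W(3) by (intro sum.mono_neutral_cong_right) auto
    also have "\<dots> = (\<Sum>k<n. c k * M $$ (k, j)) - (\<Sum>k\<in>?V. c k * M $$ (k, j))"
      using sum.subset_diff[OF W(3), of "\<lambda>k. c k * M $$ (k, j)"] by simp
    finally have "(\<Sum>k<n. c' k * M $$ (k, j))
        = (\<Sum>k<n. c k * M $$ (k, j)) - (\<Sum>a\<in>?V. (2 * c a) * ((M $$ (a, j) + M $$ (s, j)) / 2))"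
      unfolding V by simp
    also have "\<dots> \<in> \<int>"
    proof (rule Ints_diff)
      show "(\<Sum>k<n. c k * M $$ (k, j)) \<in> \<int>" using c M j by (auto simp: lat_def)
      show "(\<Sum>a\<in>?V. (2 * c a) * ((M $$ (a, j) + M $$ (s, j)) / 2)) \<in> \<int>"
      proof (rule Ints_sum, rule Ints_mult)
        fix a assume a: "a \<in> ?V"
        then show "2 * c a \<in> \<int>" by (simp add: W_def)
        show "(M $$ (a, j) + M $$ (s, j)) / 2 \<in> \<int>"
          using a s(1) j by (intro te_interlace_half_sum[OF inter M]) auto
      qed
    qed
    finally show "(\<Sum>k<dim_row M. c' k * M $$ (k, j)) \<in> \<int>" using M by simp
  qed
  have c's: "2 * c' s \<notin> \<int>"
  proof
    assume "2 * c' s \<in> \<int>"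
    moreover have "(\<Sum>a\<in>{..<n} - W. 2 * c a) \<in> \<int>" by (rule Ints_sum) (simp add: W_def)
    ultimately have "2 * c' s + (\<Sum>a\<in>{..<n} - W. 2 * c a) \<in> \<int>" by (rule Ints_add)
    moreover have "2 * c' s + (\<Sum>a\<in>{..<n} - W. 2 * c a) = 2 * c s"
      using W(1) by (simp add: c'_def sum_distrib_left)
    ultimately show False using s(2) by simp
  qed
  have c'0: "c' k = 0" if "k \<notin> W" for k using that W(1) by (auto simp: c'_def)
  define R where "R = insert i W"
  define r where "r = card R"
  have rW: "r = Suc (card W)" using W by (simp add: r_def R_def)
  have Rn: "R \<subseteq> {..<n}" using W i by (auto simp: R_def)
  have R: "R \<subseteq> {..<dim_row M}" using Rn M by simp
  have ind: "rows_indep M R" by (rule rows_indep_subset[OF indn Rn]) simp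
  define f where "f = pick R"
  have f: "bij_betw f {..<r} R" unfolding f_def r_def by (rule pick_enum) (simp add: R_def W(4))
  obtain g where g: "inj_on g {..<r}" "g ` {..<r} \<subseteq> {..<dim_col M}" "minor M r f g \<noteq> 0"
    using exists_nonzero_maximal_minor[OF f ind] .
  define N where "N = binv M r f g"
  have "\<exists>e. lat M e \<and> (\<forall>i<dim_row M. i \<notin> R \<longrightarrow> e i = 0) \<and> (\<forall>s<r. e (f s) = N l s)" if "l < r" for l
    using te_binv_row_lat[OF te ind R f g that] unfolding N_def by metis
  then obtain e where e: "\<And>l. l < r \<Longrightarrow> lat M (e l)" "\<And>l s. l < r \<Longrightarrow> s < r \<Longrightarrow> e l (f s) = N l s"
    by metis
  have fn: "f t < n" if "t < r" for t using f Rn that by (auto simp: bij_betw_def)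
  have gd: "g t < d" if "t < r" for t using g(2) M that by auto
  have entry: "M $$ (k, g l) = 1 \<or> M $$ (k, g l) = -1" if "l < r" "k < n" for k l
  proof -
    have "\<exists>t<r. M $$ (f t, g l) \<noteq> 0"
    proof (rule ccontr)
      assume "\<not> ?thesis"
      then have "(\<Sum>t<r. N l t * M $$ (f t, g l)) = 0" by (intro sum.neutral) auto
      then show False using binv_left[OF g(3) that(1) that(1)] by (simp add: N_def)
    qed
    then show ?thesis using te_interlace_entry[OF inter M that(2) gd[OF that(1)]] fn by blast
  qed
  have "s \<in> f ` {..<r}" using f W(1) by (auto simp: bij_betw_def R_def)
  then obtain s0 where s0: "s0 < r" "f s0 = s" by auto
  \<comment> \<open>The number \<open>c' s\<close> is an integral combination of column
    \<open>s0\<close> of the inverse; it would lie in \<int>/2 if that column did.\<close>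
  have "\<exists>l<r. 2 * N l s0 \<notin> \<int>"
  proof (rule ccontr)
    assume "\<not> ?thesis"
    then have *: "2 * N l s0 \<in> \<int>" if "l < r" for l using that by blast
    have "c' (f s0) = (\<Sum>l<r. (\<Sum>t<r. c' (f t) * M $$ (f t, g l)) * N l s0)"
      using coord_eq_binv[OF g(3) s0(1), of "\<lambda>t. c' (f t)"] by (simp add: N_def)
    then have "2 * c' s = (\<Sum>l<r. (\<Sum>t<r. c' (f t) * M $$ (f t, g l)) * (2 * N l s0))"
      using s0(2) by (simp add: sum_distrib_left mult.left_commute)
    also have "\<dots> \<in> \<int>"
    proof (rule Ints_sum, rule Ints_mult)
      fix l assume l: "l \<in> {..<r}"
      show "(\<Sum>t<r. c' (f t) * M $$ (f t, g l)) \<in> \<int>"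
        by (rule lat_supported_Ints[OF c'_lat f R]) (use c'0 l g(2) in \<open>auto simp: R_def\<close>)
      show "2 * N l s0 \<in> \<int>" using * l by simp
    qed
    finally show False using c's by simp
  qed
  then obtain l0 where l0: "l0 < r" "2 * N l0 s0 \<notin> \<int>" by blast
  have N_odd: "2 * N l s0 \<notin> \<int>" if l: "l < r" for l
  proof
    assume ls: "2 * N l s0 \<in> \<int>"
    \<comment> \<open>A nonzero entry of row \<open>l\<close> at a position in \<open>W\<close> has
      the absolute value of the entry of row \<open>l0\<close> there, which is odd. So row
      \<open>l\<close> would be odd at \<open>t\<close> and, since all lattice points with odd
      coordinates share their positions, also at \<open>s0\<close>.\<close>
    have zero: "N l t = 0" if t: "t < r" "f t \<in> W" for t
    proof (rule ccontr)
      assume nz: "N l t \<noteq> 0"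
      have "2 * e l0 (f s0) \<notin> \<int>" using e(2)[OF l0(1) s0(1)] l0(2) by simp
      moreover have "2 * c (f t) \<notin> \<int>" using t(2) by (simp add: W_def)
      ultimately have "2 * e l0 (f t) \<notin> \<int>"
        by (rule same[OF e(1)[OF l0(1)] c fn[OF s0(1)] fn[OF t(1)]])
      then have odd0: "2 * N l0 t \<notin> \<int>" using e(2)[OF l0(1) t(1)] by simp
      then have "N l0 t \<noteq> 0" by auto
      then have "\<bar>N l t\<bar> = \<bar>N l0 t\<bar>"
        using te_binv_abs_eq[OF te ind R f g(1,2) l l0(1) t(1)] nz by (simp add: N_def)
      then have "N l t = N l0 t \<or> N l t = - N l0 t" by linarith
      then have "2 * N l t \<notin> \<int>" using odd0 by auto
      then have "2 * e l (f t) \<notin> \<int>" using e(2)[OF l t(1)] by simp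
      moreover have "2 * c' (f s0) \<notin> \<int>" using c's s0(2) by simp
      ultimately have "2 * e l (f s0) \<notin> \<int>"
        by (rule same[OF e(1)[OF l] c'_lat fn[OF t(1)] fn[OF s0(1)]])
      then show False using e(2)[OF l s0(1)] ls by simp
    qed
    have "i \<in> f ` {..<r}" using f by (auto simp: bij_betw_def R_def)
    then obtain i0 where i0: "i0 < r" "f i0 = i" by auto
    \<comment> \<open>Row \<open>l\<close> is now concentrated at the extra row \<open>i\<close>.
      Its product with some column \<open>g k\<close> other than \<open>g l\<close> is zero, and
      that column has the entry 1 or -1 at row \<open>i\<close>, so the whole row vanishes, which an
      inverse does not allow.\<close>
    have row: "(\<Sum>t<r. N l t * M $$ (f t, g k)) = N l i0 * M $$ (i, g k)" for k
    proof -
      have "f t \<in> W" if "t < r" "t \<noteq> i0" for t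
        using f i0 that by (auto simp: bij_betw_def R_def inj_on_def)
      then have "(\<Sum>t<r. N l t * M $$ (f t, g k)) = (\<Sum>t\<in>{i0}. N l t * M $$ (f t, g k))"
        using zero i0(1) by (intro sum.mono_neutral_right) auto
      then show ?thesis using i0(2) by simp
    qed
    have "0 < card W" using W(1,4) by (auto simp: card_gt_0_iff)
    then have "1 < r" using rW by simp
    define k where "k = (if l = 0 then 1 else 0 :: nat)"
    have k: "k < r" "l \<noteq> k" using \<open>1 < r\<close> by (auto simp: k_def)
    have "N l i0 * M $$ (i, g k) = 0"
      using binv_left[OF g(3) l k(1)] row[of k] k(2) by (simp add: N_def)
    then have "N l i0 = 0" using entry[OF k(1) i] by auto
    then show False using binv_left[OF g(3) l l] row[of l] by (simp add: N_def)
  qed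
  \<comment> \<open>Here the counting runs down column \<open>s0\<close> of the inverse, paired with
    row \<open>s\<close> of the submatrix: all \<open>r\<close> entries are odd, so \<open>r\<close>
    is even, although it exceeds the even number \<open>card W\<close> by one.\<close>
  have "(\<Sum>k<r. N k s0 * M $$ (s, g k)) = 1"
    using binv_right[OF g(3) s0(1) s0(1)] s0(2) by (simp add: N_def mult.commute)
  then have "even (card {k\<in>{..<r}. 2 * N k s0 \<notin> \<int>})"
  proof (intro even_card_of_odd_quarters[where m = "\<lambda>k. M $$ (s, g k)"])
    fix k assume "k \<in> {..<r}"
    then have k: "k < r" by simp
    show "4 * N k s0 \<in> \<int>" using quarter[OF e(1)[OF k] fn[OF s0(1)]] e(2)[OF k s0(1)] by simp
    show "M $$ (s, g k) = 1 \<or> M $$ (s, g k) = -1" by (rule entry[OF k s(1)])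
  qed auto
  moreover have "{k\<in>{..<r}. 2 * N k s0 \<notin> \<int>} = {..<r}" using N_odd by auto
  ultimately show False using evenW rW by simp
qed

section \<open>The Hilbert bases\<close>

text \<open>Every entry of a nonzero column is odd, so its signs leave the parity of the sum of the
  \<open>y k\<close> unchanged. The doubled product with the column is thus even.\<close>

lemma te_interlace_lat_of_even_sum:
  assumes inter: "te_interlace M {..<n}" and M: "M \<in> carrier_mat n d"
    and y: "\<And>k. k < n \<Longrightarrow> 2 * x k = real_of_int (y k)" and even: "even (\<Sum>k<n. y k)"
  shows "lat M x"
  unfolding lat_def
proof (intro allI impI)
  fix j assume "j < dim_col M"
  then have j: "j < d" using M by simp
  have dim: "dim_row M = n" using M by simp
  show "(\<Sum>k<dim_row M. x k * M $$ (k, j)) \<in> \<int>"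
  proof (cases "\<exists>i<n. M $$ (i, j) \<noteq> 0")
    case False
    then have "(\<Sum>k<n. x k * M $$ (k, j)) = 0" by (intro sum.neutral) auto
    then show ?thesis unfolding dim by simp
  next
    case True
    then have m: "M $$ (k, j) = 1 \<or> M $$ (k, j) = -1" if "k < n" for k
      using te_interlace_entry[OF inter M that j] by blast
    define s where "s k = (if M $$ (k, j) = 1 then 1 else - 1 :: int)" for k
    have s: "M $$ (k, j) = real_of_int (s k)" "even (s k - 1)" if "k < n" for k
      using m[OF that] by (auto simp: s_def)
    have "(\<Sum>k<n. y k * s k) = (\<Sum>k<n. y k) + (\<Sum>k<n. y k * (s k - 1))"
      by (simp add: algebra_simps flip: sum.distrib)
    moreover have "even (\<Sum>k<n. y k * (s k - 1))" by (intro dvd_sum dvd_mult s(2)) simp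
    ultimately have "even (\<Sum>k<n. y k * s k)" using even by simp
    then obtain z where z: "(\<Sum>k<n. y k * s k) = 2 * z" by (rule evenE)
    have "2 * (\<Sum>k<n. x k * M $$ (k, j)) = (\<Sum>k<n. (2 * x k) * M $$ (k, j))"
      by (simp add: sum_distrib_left mult.assoc)
    also have "\<dots> = (\<Sum>k<n. real_of_int (y k * s k))"
      by (intro sum.cong) (auto simp: y s(1))
    also have "\<dots> = real_of_int (2 * z)" unfolding z[symmetric] by simp
    finally have "(\<Sum>k<n. x k * M $$ (k, j)) = of_int z" by simp
    then show ?thesis unfolding dim by simp
  qed
qed

definition three_quarter_coord :: "nat \<Rightarrow> nat \<Rightarrow> real" where
  "three_quarter_coord i k = (if k = i then 3/4 else 1/4)"

text \<open>Some lattice point \<open>q\<close> has only odd coordinates, so \<open>q\<close> minus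
  the constant 1/4 is half-integral with doubled coordinates \<open>y\<close>. If their sum is even,
  this difference is in the lattice and hence so is the constant. If it is odd, raising any one
  entry of the constant by 1/2 corrects the parity.\<close>

lemma thick_te_interlace_lat_cases:
  assumes thick: "thick_te_interlace M {..<n}" and M: "M \<in> carrier_mat n d"
  shows "lat M (\<lambda>_. 1/4) \<or> (\<forall>i<n. lat M (three_quarter_coord i))"
proof -
  have inter: "te_interlace M {..<n}" using thick by (simp add: thick_te_interlace_def)
  have dim: "dim_row M = n" using M by simp
  obtain q i0 where q: "lat M q" "i0 < n" "2 * q i0 \<notin> \<int>"
    using thick_te_interlace_exists_odd[OF thick M] .
  have "\<exists>z. 2 * (q k - 1/4) = real_of_int z" if k: "k < n" for k
  proof -
    have "2 * (2 * q k) \<in> \<int>" using thick_te_interlace_quarter_Ints[OF thick M q(1) k] by simp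
    then have "2 * q k - 1/2 \<in> \<int>"
      using half_Ints_cases thick_te_interlace_all_odd[OF thick M q k] by blast
    then obtain z where "2 * q k - 1/2 = of_int z" by (rule Ints_cases)
    then show ?thesis by (intro exI[of _ z]) simp
  qed
  then obtain y where y: "\<And>k. k < n \<Longrightarrow> 2 * (q k - 1/4) = real_of_int (y k)" by metis
  show ?thesis
  proof (cases "even (\<Sum>k<n. y k)")
    case True
    have "lat M (\<lambda>k. q k - 1/4)" by (rule te_interlace_lat_of_even_sum[OF inter M y True])
    from lat_diff[OF q(1) this] show ?thesis by simp
  next
    case False
    have "lat M (three_quarter_coord i)" if i: "i < n" for i
    proof -
      have "lat M (\<lambda>k. q k - three_quarter_coord i k)"
      proof (rule te_interlace_lat_of_even_sum[OF inter M])
        fix k assume "k < n"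
        then show "2 * (q k - three_quarter_coord i k) = real_of_int (y k - (if k = i then 1 else 0))"
          using y[of k] by (cases "k = i") (simp_all add: three_quarter_coord_def)
      next
        show "even (\<Sum>k<n. y k - (if k = i then 1 else 0))"
          using False i by (simp add: sum_subtractf)
      qed
      from lat_diff[OF q(1) this] show ?thesis by simp
    qed
    then show ?thesis by blast
  qed
qed

lemma te_interlace_column_counts:
  assumes inter: "te_interlace M {..<n}" and M: "M \<in> carrier_mat n d"
    and j: "j < d" and nz: "\<exists>i<n. M $$ (i, j) \<noteq> 0"
  shows "(\<Sum>i<n. M $$ (i, j)) = real (card {i. i < n \<and> M $$ (i, j) = 1}) - real (card {i. i < n \<and> M $$ (i, j) = -1})"
    and "n = card {i. i < n \<and> M $$ (i, j) = 1} + card {i. i < n \<and> M $$ (i, j) = -1}"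
proof -
  let ?P = "{i. i < n \<and> M $$ (i, j) = 1}" and ?N = "{i. i < n \<and> M $$ (i, j) = -1}"
  have un: "{..<n} = ?P \<union> ?N" using te_interlace_entry[OF inter M _ j] nz by blast
  have dis: "?P \<inter> ?N = {}" by auto
  have "(\<Sum>i<n. M $$ (i, j)) = (\<Sum>i\<in>?P. M $$ (i, j)) + (\<Sum>i\<in>?N. M $$ (i, j))"
    unfolding un by (rule sum.union_disjoint) (use dis in auto)
  then show "(\<Sum>i<n. M $$ (i, j)) = real (card ?P) - real (card ?N)" by simp
  have "card {..<n} = card ?P + card ?N" unfolding un by (rule card_Un_disjoint) (use dis in auto)
  then show "n = card ?P + card ?N" by simp
qed

section \<open>From coordinates to vectors\<close>

lemma hilbert_basis_coords:
  assumes M: "M \<in> carrier_mat n d" and ind: "rows_indep M {..<n}" and fin: "finite K"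
    and K: "\<And>k. k \<in> K \<Longrightarrow> lat M k \<and> (\<exists>i<n. 1/4 \<le> k i) \<and> (\<forall>i<n. 0 \<le> k i)"
    and gen: "\<And>c. lat M c \<Longrightarrow> (\<And>i. i < n \<Longrightarrow> 0 \<le> c i) \<Longrightarrow> \<exists>i<n. c i \<noteq> 0 \<Longrightarrow> \<exists>k\<in>K. \<forall>i<n. k i \<le> c i"
    and irr: "\<And>k u. k \<in> K \<Longrightarrow> lat M u \<Longrightarrow> (\<And>i. i < n \<Longrightarrow> 0 \<le> u i \<and> u i \<le> k i) \<Longrightarrow>
      (\<forall>i<n. u i = 0) \<or> (\<forall>i<n. u i = k i)"
  shows "hilbert_basis d (cone_rows M) = row_comb M ` K"
proof -
  have "dim_row M = n" "dim_col M = d" using M by auto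
  from hilbert_basis_cone_rows[of M K, unfolded this, OF ind fin K gen irr] show ?thesis .
qed

lemma row_comb_unit_coord:
  assumes "M \<in> carrier_mat n d" "a < n"
  shows "row_comb M (unit_coord a) = row M a"
  using assms by (intro eq_vecI) (auto simp: row_comb_def sum_unit_coord)

lemma row_comb_half_pair:
  assumes "M \<in> carrier_mat n d" "a < n" "b < n"
  shows "row_comb M (half_pair a b) = (1/2) \<cdot>\<^sub>v (row M a + row M b)"
  using assms by (intro eq_vecI) (auto simp: row_comb_def sum_half_pair)

lemma row_comb_const:
  assumes "M \<in> carrier_mat n d"
  shows "row_comb M (\<lambda>_. x) = x \<cdot>\<^sub>v rsum M {..<n}"
  using assms by (intro eq_vecI) (auto simp: row_comb_def rsum_def sum_distrib_left)

lemma row_comb_three_quarter_coord: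
  assumes "M \<in> carrier_mat n d" "i < n"
  shows "row_comb M (three_quarter_coord i) = (3/4) \<cdot>\<^sub>v row M i + (1/4) \<cdot>\<^sub>v rsum M ({..<n} - {i})"
proof (intro eq_vecI)
  fix j assume "j < dim_vec ((3/4) \<cdot>\<^sub>v row M i + (1/4) \<cdot>\<^sub>v rsum M ({..<n} - {i}))"
  then have j: "j < dim_col M" by (simp add: rsum_def)
  have "(\<Sum>k<n. three_quarter_coord i k * M $$ (k, j))
      = three_quarter_coord i i * M $$ (i, j) + (\<Sum>k\<in>{..<n} - {i}. three_quarter_coord i k * M $$ (k, j))"
    using assms(2) by (intro sum.remove) auto
  also have "(\<Sum>k\<in>{..<n} - {i}. three_quarter_coord i k * M $$ (k, j)) = (\<Sum>k\<in>{..<n} - {i}. 1/4 * M $$ (k, j))"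
    by (intro sum.cong) (auto simp: three_quarter_coord_def)
  finally show "row_comb M (three_quarter_coord i) $ j
      = ((3/4) \<cdot>\<^sub>v row M i + (1/4) \<cdot>\<^sub>v rsum M ({..<n} - {i})) $ j"
    using assms j by (simp add: row_comb_def rsum_def three_quarter_coord_def sum_distrib_left)
qed (simp add: row_comb_def rsum_def)

lemma row_comb_image_unit_coord:
  assumes "M \<in> carrier_mat n d"
  shows "row_comb M ` unit_coord ` {..<n} = {row M i | i. i < n}"
  using row_comb_unit_coord[OF assms] by (auto simp: image_image image_iff)

lemma row_comb_image_short_coords:
  assumes M: "M \<in> carrier_mat n d"
  shows "row_comb M ` short_coords n
    = {row M i | i. i < n} \<union> {(1/2) \<cdot>\<^sub>v (row M i + row M j) | i j. i < j \<and> j < n}"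
proof -
  have "row_comb M ` {half_pair a b | a b. a < b \<and> b < n}
      = {row_comb M (half_pair a b) | a b. a < b \<and> b < n}" by blast
  also have "\<dots> = {(1/2) \<cdot>\<^sub>v (row M i + row M j) | i j. i < j \<and> j < n}"
    using row_comb_half_pair[OF M] by (metis (no_types, opaque_lifting) order.strict_trans)
  finally show ?thesis
    unfolding short_coords_def image_Un row_comb_image_unit_coord[OF M] by simp
qed

lemma finite_short_coords: "finite (short_coords n)"
proof -
  have "{half_pair a b | a b. a < b \<and> b < n} \<subseteq> (\<lambda>(a, b). half_pair a b) ` ({..<n} \<times> {..<n})"
    by force
  then have "finite {half_pair a b | a b. a < b \<and> b < n}" by (rule finite_subset) simp
  then show ?thesis unfolding short_coords_def by simp
qed

lemma Ints_unit_coord_below: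
  assumes "\<And>i. i < n \<Longrightarrow> c i \<in> \<int>" "\<And>i. i < n \<Longrightarrow> 0 \<le> c i" "\<exists>i<n. c i \<noteq> 0"
  shows "\<exists>k\<in>unit_coord ` {..<n}. \<forall>i<n. k i \<le> c i"
proof -
  obtain i where i: "i < n" "c i \<noteq> 0" using assms(3) by blast
  then obtain z where "c i = of_int z" using assms(1) by (blast elim: Ints_cases)
  then have "1 \<le> c i" using assms(2)[OF i(1)] i(2) by simp
  then show ?thesis using i(1) assms(2) by (intro bexI[of _ "unit_coord i"]) (auto simp: unit_coord_def)
qed

lemma Ints_le_unit_coord:
  assumes a: "a < n" and u: "\<And>i. i < n \<Longrightarrow> 0 \<le> u i \<and> u i \<le> unit_coord a i" and "u a \<in> \<int>"
  shows "(\<forall>i<n. u i = 0) \<or> (\<forall>i<n. u i = unit_coord a i)"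
proof -
  obtain z where z: "u a = of_int z" using assms(3) by (rule Ints_cases)
  have 0: "u i = 0" if "i < n" "i \<noteq> a" for i using u[OF that(1)] that(2) by (simp add: unit_coord_def)
  have "0 \<le> u a" "u a \<le> 1" using u[OF a] by (auto simp: unit_coord_def)
  then have "z = 0 \<or> z = 1" using z by auto
  then have "u a = 0 \<or> u a = 1" using z by auto
  then show ?thesis
  proof
    assume "u a = 0"
    then have "u i = 0" if "i < n" for i using 0 that by (cases "i = a") auto
    then show ?thesis by blast
  next
    assume "u a = 1"
    then have "u i = unit_coord a i" if "i < n" for i
      using 0 that by (cases "i = a") (auto simp: unit_coord_def)
    then show ?thesis by blast
  qed
qed

lemma unit_coord_admissible:
  assumes "pm_mat M" "a < n"
  shows "lat M (unit_coord a) \<and> (\<exists>i<n. 1/4 \<le> unit_coord a i) \<and> (\<forall>i<n. 0 \<le> unit_coord a i)"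
  using assms lat_unit_coord by (auto simp: unit_coord_def)

lemma short_coords_admissible:
  assumes inter: "te_interlace M {..<n}" and M: "M \<in> carrier_mat n d" and k: "k \<in> short_coords n"
  shows "lat M k \<and> (\<exists>i<n. 1/4 \<le> k i) \<and> (\<forall>i<n. 0 \<le> k i)"
proof -
  have pm: "pm_mat M" using inter by (simp add: te_interlace_def te_set_def)
  consider a where "a < n" "k = unit_coord a" | a b where "a < b" "b < n" "k = half_pair a b"
    using k by (auto simp: short_coords_def)
  then show ?thesis
  proof cases
    case 1
    then show ?thesis using unit_coord_admissible[OF pm] by simp
  next
    case 2
    then have "lat M k" using te_interlace_lat_half_pair[OF inter M] by simp
    moreover have "1/4 \<le> k b" "\<forall>i<n. 0 \<le> k i" using 2 by (auto simp: half_pair_def unit_coord_def)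
    ultimately show ?thesis using 2(2) by blast
  qed
qed

section \<open>Tu-sets, te-laces and thin te-interlaces\<close>

theorem hilbert_basis_tu_set:
  assumes tu: "tu_set M {..<n}" and M: "M \<in> carrier_mat n d"
  shows "hilbert_basis d (cone_rows M) = {row M i | i. i < n}"
proof -
  have ind: "rows_indep M {..<n}" and pm: "pm_mat M" using tu by (auto simp: tu_set_def)
  have int: "c i \<in> \<int>" if "lat M c" "i < n" for c i
    by (rule tu_set_lat_Ints[OF tu that(1)]) (use M that(2) in auto)
  have "hilbert_basis d (cone_rows M) = row_comb M ` unit_coord ` {..<n}"
  proof (rule hilbert_basis_coords[OF M ind])
    fix k assume "k \<in> unit_coord ` {..<n}"
    then show "lat M k \<and> (\<exists>i<n. 1/4 \<le> k i) \<and> (\<forall>i<n. 0 \<le> k i)"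
      using unit_coord_admissible[OF pm] by auto
  next
    fix c assume "lat M c" "\<And>i. i < n \<Longrightarrow> 0 \<le> c i" "\<exists>i<n. c i \<noteq> 0"
    then show "\<exists>k\<in>unit_coord ` {..<n}. \<forall>i<n. k i \<le> c i"
      by (intro Ints_unit_coord_below int)
  next
    fix k u assume k: "k \<in> unit_coord ` {..<n}" and u: "lat M u" "\<And>i. i < n \<Longrightarrow> 0 \<le> u i \<and> u i \<le> k i"
    then obtain a where a: "a < n" "k = unit_coord a" by auto
    show "(\<forall>i<n. u i = 0) \<or> (\<forall>i<n. u i = k i)"
      unfolding a(2) by (rule Ints_le_unit_coord[OF a(1) u(2)[unfolded a(2)] int[OF u(1) a(1)]])
  qed simp
  then show ?thesis unfolding row_comb_image_unit_coord[OF M] .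
qed

theorem hilbert_basis_te_lace:
  assumes lace: "te_lace M {..<n}" and M: "M \<in> carrier_mat n d"
  shows "hilbert_basis d (cone_rows M) = {row M i | i. i < n} \<union> {(1/2) \<cdot>\<^sub>v rsum M {..<n}}"
proof -
  have ind: "rows_indep M {..<n}" and pm: "pm_mat M" using lace by (auto simp: te_lace_def te_set_def)
  note n = te_lace_lat(1)[OF lace M]
  let ?K = "unit_coord ` {..<n} \<union> {\<lambda>_. 1/2}"
  have "hilbert_basis d (cone_rows M) = row_comb M ` ?K"
  proof (rule hilbert_basis_coords[OF M ind])
    fix k assume "k \<in> ?K"
    moreover have "\<exists>i. i < n" using n by (intro exI[of _ 0]) simp
    ultimately show "lat M k \<and> (\<exists>i<n. 1/4 \<le> k i) \<and> (\<forall>i<n. 0 \<le> k i)"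
      using unit_coord_admissible[OF pm] te_lace_lat(2)[OF lace M] by auto
  next
    fix c assume c: "lat M c" "\<And>i. i < n \<Longrightarrow> 0 \<le> c i" "\<exists>i<n. c i \<noteq> 0"
    from te_lace_lat(3)[OF lace M c(1)] show "\<exists>k\<in>?K. \<forall>i<n. k i \<le> c i"
    proof
      assume "\<forall>i<n. c i \<in> \<int>"
      then show ?thesis using Ints_unit_coord_below[of n c] c(2,3) by blast
    next
      assume half: "\<forall>i<n. c i - 1/2 \<in> \<int>"
      have "1/2 \<le> c i" if i: "i < n" for i
      proof -
        obtain z where z: "c i - 1/2 = of_int z" using half i by (blast elim: Ints_cases)
        then have "- 1 < real_of_int z" using c(2)[OF i] by linarith
        then have "0 \<le> z" by linarith
        then have "0 \<le> real_of_int z" by simp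
        then show ?thesis using z by linarith
      qed
      then show ?thesis by (intro bexI[of _ "\<lambda>_. 1/2"]) auto
    qed
  next
    fix k u assume k: "k \<in> ?K" and u: "lat M u" "\<And>i. i < n \<Longrightarrow> 0 \<le> u i \<and> u i \<le> k i"
    note cases = te_lace_lat(3)[OF lace M u(1)]
    have nonint: "(0 :: real) - 1/2 \<notin> \<int>" by (auto elim!: Ints_cases)
    from k consider a where "a < n" "k = unit_coord a" | "k = (\<lambda>_. 1/2)" by auto
    then show "(\<forall>i<n. u i = 0) \<or> (\<forall>i<n. u i = k i)"
    proof cases
      case 1
      \<comment> \<open>A te-lace has a second row \<open>b\<close>. The coordinate
        \<open>u b\<close> is 0 and not in 1/2 + \<int>, which puts \<open>u\<close> into the
        integral case.\<close>
      define b where "b = (if a = 0 then 1 else 0 :: nat)"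
      have b: "b < n" "b \<noteq> a" using n by (auto simp: b_def)
      have "u b = 0" using u(2)[OF b(1)] b 1 by (simp add: unit_coord_def)
      then have "\<not> (\<forall>i<n. u i - 1/2 \<in> \<int>)" using nonint b(1) by metis
      then have ua: "u a \<in> \<int>" using cases 1(1) by blast
      show ?thesis unfolding 1(2) by (rule Ints_le_unit_coord[OF 1(1) u(2)[unfolded 1(2)] ua])
    next
      case 2
      have bd: "0 \<le> u i" "u i \<le> 1/2" if "i < n" for i using u(2)[OF that] 2 by auto
      from cases show ?thesis
      proof
        assume int: "\<forall>i<n. u i \<in> \<int>"
        have "u i = 0" if i: "i < n" for i
        proof -
          obtain z where z: "u i = of_int z" using int i by (blast elim: Ints_cases)
          then have "- 1 < real_of_int z" "real_of_int z < 1" using bd[OF i] by linarith+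
          then have "z = 0" by linarith
          then show ?thesis using z by simp
        qed
        then show ?thesis by blast
      next
        assume half: "\<forall>i<n. u i - 1/2 \<in> \<int>"
        have "u i = k i" if i: "i < n" for i
        proof -
          obtain z where z: "u i - 1/2 = of_int z" using half i by (blast elim: Ints_cases)
          then have "- 1 < real_of_int z" "real_of_int z < 1" using bd[OF i] by linarith+
          then have "z = 0" by linarith
          then show ?thesis using z 2 by simp
        qed
        then show ?thesis by blast
      qed
    qed
  qed simp
  then show ?thesis
    unfolding image_Un row_comb_image_unit_coord[OF M] using row_comb_const[OF M] by simp
qed

text \<open>The denominator bound uses three distinct rows, so two rows are treated as the te-lace
  they form; their only half sum is then half the sum of all rows.\<close>

theorem hilbert_basis_thin_te_interlace:
  assumes thin: "thin_te_interlace M {..<n}" and M: "M \<in> carrier_mat n d"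
  shows "hilbert_basis d (cone_rows M)
    = {row M i | i. i < n} \<union> {(1/2) \<cdot>\<^sub>v (row M i + row M j) | i j. i < j \<and> j < n}"
proof -
  have inter: "te_interlace M {..<n}" using thin by (simp add: thin_te_interlace_def)
  have ind: "rows_indep M {..<n}" using inter by (simp add: te_interlace_def te_set_def)
  show ?thesis
  proof (cases "n = 2")
    case True
    have two: "{..<n} = {0, 1}" using True by auto
    have lace: "te_lace M {..<n}" using inter unfolding te_interlace_def two by simp
    have "{(1/2) \<cdot>\<^sub>v (row M i + row M j) | i j. i < j \<and> j < n} = {(1/2) \<cdot>\<^sub>v (row M 0 + row M 1)}"
    proof -
      have "i < j \<and> j < n \<longleftrightarrow> i = 0 \<and> j = 1" for i j using True by auto
      then show ?thesis by simp
    qed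
    moreover have "rsum M {..<n} = row M 0 + row M 1"
      using M True by (intro eq_vecI) (auto simp: rsum_def numeral_2_eq_2)
    ultimately show ?thesis using hilbert_basis_te_lace[OF lace M] by simp
  next
    case False
    then have n: "3 \<le> n" using te_interlace_ge_2[OF inter M] by simp
    note half = thin_te_interlace_half_Ints[OF thin M n]
    have "hilbert_basis d (cone_rows M) = row_comb M ` short_coords n"
      by (rule hilbert_basis_coords[OF M ind finite_short_coords short_coords_admissible[OF inter M]
            te_interlace_short_below[OF inter M] te_interlace_short_irreducible[OF inter M]])
        (use half in auto)
    then show ?thesis unfolding row_comb_image_short_coords[OF M] .
  qed
qed

section \<open>Thick te-interlaces\<close>

lemma odd_quarter_bounds:
  fixes x :: real
  assumes "4 * x \<in> \<int>" "2 * x \<notin> \<int>" "0 \<le> x"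
  shows "1/4 \<le> x" "x = 1/4 \<or> 3/4 \<le> x"
proof -
  obtain z where z: "4 * x = of_int z" using assms(1) by (rule Ints_cases)
  have "odd z" using quarter_half_Ints_iff[OF z] assms(2) by simp
  moreover have "0 \<le> z" using z assms(3) by simp
  ultimately have "z = 1 \<or> 3 \<le> z" by presburger
  then have "real_of_int z = 1 \<or> 3 \<le> real_of_int z" by auto
  then show "1/4 \<le> x" "x = 1/4 \<or> 3/4 \<le> x" using z by auto
qed

lemma half_Ints_le_half:
  fixes x :: real
  assumes "2 * x \<in> \<int>" "0 \<le> x" "x < 1"
  shows "x = 0 \<or> x = 1/2"
proof -
  obtain z where z: "2 * x = of_int z" using assms(1) by (rule Ints_cases)
  then have "z = 0 \<or> z = 1" using assms(2,3) by linarith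
  then show ?thesis using z by auto
qed

lemma thick_te_interlace_parity_cases:
  assumes thick: "thick_te_interlace M {..<n}" and M: "M \<in> carrier_mat n d" and c: "lat M c"
  shows "(\<forall>i<n. 2 * c i \<in> \<int>) \<or> (\<forall>i<n. 2 * c i \<notin> \<int>)"
  using thick_te_interlace_all_odd[OF thick M c] by blast

text \<open>Among three rows there is one where \<open>k\<close> vanishes, and then \<open>u\<close>
  does too. As coordinates are all odd or all half-integral, \<open>u\<close> is half-integral and
  the common irreducibility argument applies.\<close>

lemma thick_te_interlace_short_irreducible:
  assumes thick: "thick_te_interlace M {..<n}" and M: "M \<in> carrier_mat n d"
    and k: "k \<in> short_coords n" and u: "lat M u" "\<And>i. i < n \<Longrightarrow> 0 \<le> u i \<and> u i \<le> k i"
  shows "(\<forall>i<n. u i = 0) \<or> (\<forall>i<n. u i = k i)"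
proof -
  have inter: "te_interlace M {..<n}" using thick by (simp add: thick_te_interlace_def)
  note n = thick_te_interlace_ge_3[OF thick M]
  obtain a b where ab: "k = unit_coord a \<or> k = half_pair a b"
    using k by (auto simp: short_coords_def)
  have "{..<n} - {a, b} \<noteq> {}"
  proof
    assume "{..<n} - {a, b} = {}"
    then have "card {..<n} \<le> card {a, b}" by (intro card_mono) auto
    then show False using n card_insert_le_m1[of 2 "{b}" a] by simp
  qed
  then obtain h where h: "h < n" "h \<noteq> a" "h \<noteq> b" by blast
  then have "k h = 0" using ab by (auto simp: unit_coord_def half_pair_def)
  then have "u h = 0" using u(2)[OF h(1)] by simp
  then have "2 * u h \<in> \<int>" by simp
  then have half: "2 * u i \<in> \<int>" if "i < n" for i
    using thick_te_interlace_parity_cases[OF thick M u(1)] h(1) that by blast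
  show ?thesis by (rule te_interlace_short_irreducible[OF inter M k u half])
qed

text \<open>A nonnegative lattice point that is not half-integral has all coordinates at least 1/4,
  so the constant 1/4 lies below it. The same bound makes the constant irreducible, since a
  half-integral point below it is zero.\<close>

lemma hilbert_basis_thick_te_interlace_quarter:
  assumes thick: "thick_te_interlace M {..<n}" and M: "M \<in> carrier_mat n d"
    and q: "lat M (\<lambda>_. 1/4)"
  shows "hilbert_basis d (cone_rows M) = {row M i | i. i < n} \<union>
    {(1/2) \<cdot>\<^sub>v (row M i + row M j) | i j. i < j \<and> j < n} \<union> {(1/4) \<cdot>\<^sub>v rsum M {..<n}}"
proof -
  have inter: "te_interlace M {..<n}" using thick by (simp add: thick_te_interlace_def)
  have ind: "rows_indep M {..<n}" using inter by (simp add: te_interlace_def te_set_def)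
  have n0: "0 < n" using thick_te_interlace_ge_3[OF thick M] by simp
  note quarter = thick_te_interlace_quarter_Ints[OF thick M]
  let ?K = "short_coords n \<union> {\<lambda>_. 1/4}"
  have "hilbert_basis d (cone_rows M) = row_comb M ` ?K"
  proof (rule hilbert_basis_coords[OF M ind])
    fix k assume "k \<in> ?K"
    then show "lat M k \<and> (\<exists>i<n. 1/4 \<le> k i) \<and> (\<forall>i<n. 0 \<le> k i)"
    proof
      assume "k \<in> {\<lambda>_. 1/4}"
      then show ?thesis using q n0 by auto
    qed (rule short_coords_admissible[OF inter M])
  next
    fix c assume c: "lat M c" "\<And>i. i < n \<Longrightarrow> 0 \<le> c i" "\<exists>i<n. c i \<noteq> 0"
    from thick_te_interlace_parity_cases[OF thick M c(1)] show "\<exists>k\<in>?K. \<forall>i<n. k i \<le> c i"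
    proof
      assume half: "\<forall>i<n. 2 * c i \<in> \<int>"
      have "\<exists>k\<in>short_coords n. \<forall>i<n. k i \<le> c i"
        by (rule te_interlace_short_below[OF inter M c]) (use half in auto)
      then show ?thesis by blast
    next
      assume odd: "\<forall>i<n. 2 * c i \<notin> \<int>"
      have "1/4 \<le> c i" if "i < n" for i
        using odd_quarter_bounds(1)[OF quarter[OF c(1) that] _ c(2)[OF that]] odd that by blast
      then show ?thesis by (intro bexI[of _ "\<lambda>_. 1/4"]) auto
    qed
  next
    fix k u assume k: "k \<in> ?K" and u: "lat M u" "\<And>i. i < n \<Longrightarrow> 0 \<le> u i \<and> u i \<le> k i"
    from k show "(\<forall>i<n. u i = 0) \<or> (\<forall>i<n. u i = k i)"
    proof
      assume "k \<in> {\<lambda>_. 1/4}"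
      then have bd: "0 \<le> u i" "u i \<le> 1/4" "k i = 1/4" if "i < n" for i using u(2)[OF that] by auto
      from thick_te_interlace_parity_cases[OF thick M u(1)] show ?thesis
      proof
        assume half: "\<forall>i<n. 2 * u i \<in> \<int>"
        have "u i = 0" if i: "i < n" for i
          using half_Ints_le_half[of "u i"] half bd[OF i] i by force
        then show ?thesis by blast
      next
        assume odd: "\<forall>i<n. 2 * u i \<notin> \<int>"
        have "u i = k i" if i: "i < n" for i
          using odd_quarter_bounds(1)[OF quarter[OF u(1) i] _ bd(1)[OF i]] odd bd[OF i] i by force
        then show ?thesis by blast
      qed
    qed (rule thick_te_interlace_short_irreducible[OF thick M _ u])
  qed (simp add: finite_short_coords)
  then show ?thesis
    unfolding image_Un row_comb_image_short_coords[OF M] using row_comb_const[OF M] by simp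
qed

text \<open>As the constant 1/4 is not in the lattice, a nonnegative point with odd coordinates has
  one that is at least 3/4, and this index selects the vector below it. Irreducibility excludes the
  constant 1/4 in the same way.\<close>

lemma hilbert_basis_thick_te_interlace_three_quarter:
  assumes thick: "thick_te_interlace M {..<n}" and M: "M \<in> carrier_mat n d"
    and nq: "\<not> lat M (\<lambda>_. 1/4)" and t: "\<forall>i<n. lat M (three_quarter_coord i)"
  shows "hilbert_basis d (cone_rows M) = {row M i | i. i < n} \<union>
    {(1/2) \<cdot>\<^sub>v (row M i + row M j) | i j. i < j \<and> j < n} \<union>
    {(3/4) \<cdot>\<^sub>v row M i + (1/4) \<cdot>\<^sub>v rsum M ({..<n} - {i}) | i. i < n}"
proof -
  have inter: "te_interlace M {..<n}" using thick by (simp add: thick_te_interlace_def)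
  have ind: "rows_indep M {..<n}" using inter by (simp add: te_interlace_def te_set_def)
  have dim: "dim_row M = n" using M by simp
  note quarter = thick_te_interlace_quarter_Ints[OF thick M]
  let ?K = "short_coords n \<union> three_quarter_coord ` {..<n}"
  have "hilbert_basis d (cone_rows M) = row_comb M ` ?K"
  proof (rule hilbert_basis_coords[OF M ind])
    fix k assume "k \<in> ?K"
    then show "lat M k \<and> (\<exists>i<n. 1/4 \<le> k i) \<and> (\<forall>i<n. 0 \<le> k i)"
    proof
      assume "k \<in> three_quarter_coord ` {..<n}"
      then obtain i where "i < n" "k = three_quarter_coord i" by auto
      then show ?thesis using t by (auto simp: three_quarter_coord_def)
    qed (rule short_coords_admissible[OF inter M])
  next
    fix c assume c: "lat M c" "\<And>i. i < n \<Longrightarrow> 0 \<le> c i" "\<exists>i<n. c i \<noteq> 0"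
    from thick_te_interlace_parity_cases[OF thick M c(1)] show "\<exists>k\<in>?K. \<forall>i<n. k i \<le> c i"
    proof
      assume half: "\<forall>i<n. 2 * c i \<in> \<int>"
      have "\<exists>k\<in>short_coords n. \<forall>i<n. k i \<le> c i"
        by (rule te_interlace_short_below[OF inter M c]) (use half in auto)
      then show ?thesis by blast
    next
      assume odd: "\<forall>i<n. 2 * c i \<notin> \<int>"
      have bd: "1/4 \<le> c i" "c i = 1/4 \<or> 3/4 \<le> c i" if "i < n" for i
        using odd_quarter_bounds[OF quarter[OF c(1) that] _ c(2)[OF that]] odd that by blast+
      have "\<exists>i<n. c i \<noteq> 1/4"
      proof (rule ccontr)
        assume "\<not> ?thesis"
        then have "lat M c \<longleftrightarrow> lat M (\<lambda>_. 1/4)" by (intro lat_cong) (auto simp: dim)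
        then show False using c(1) nq by simp
      qed
      then obtain i where i: "i < n" "3/4 \<le> c i" using bd(2) by blast
      then have "\<forall>k<n. three_quarter_coord i k \<le> c k" using bd(1) by (simp add: three_quarter_coord_def)
      then show ?thesis using i(1) by blast
    qed
  next
    fix k u assume k: "k \<in> ?K" and u: "lat M u" "\<And>i. i < n \<Longrightarrow> 0 \<le> u i \<and> u i \<le> k i"
    from k show "(\<forall>i<n. u i = 0) \<or> (\<forall>i<n. u i = k i)"
    proof
      assume "k \<in> three_quarter_coord ` {..<n}"
      then obtain i where i: "i < n" "k = three_quarter_coord i" by auto
      have bd: "0 \<le> u l" "u l \<le> three_quarter_coord i l" if "l < n" for l
        using u(2)[OF that] i(2) by auto
      have bi: "u i \<le> 3/4" and bl: "\<And>l. l < n \<Longrightarrow> l \<noteq> i \<Longrightarrow> u l \<le> 1/4"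
        using bd(2) i(1) by (force simp: three_quarter_coord_def)+
      from thick_te_interlace_parity_cases[OF thick M u(1)] show ?thesis
      proof
        assume half: "\<forall>i<n. 2 * u i \<in> \<int>"
        have 0: "u l = 0" if l: "l < n" "l \<noteq> i" for l
          using half_Ints_le_half[of "u l"] half bd(1)[OF l(1)] bl[OF l] l(1) by force
        \<comment> \<open>The bound 3/4 alone would admit the value 1/2 at \<open>i\<close>; as the
          only nonzero coordinate it would have to be integral.\<close>
        have "u i \<in> \<int>" by (rule te_interlace_single_coord_Ints[OF inter M u(1) i(1) 0])
        then obtain z where z: "u i = of_int z" by (rule Ints_cases)
        then have "z = 0" using bi bd(1)[OF i(1)] by linarith
        then have "u l = 0" if "l < n" for l using z 0 that by (cases "l = i") auto
        then show ?thesis by blast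
      next
        assume odd: "\<forall>i<n. 2 * u i \<notin> \<int>"
        have odd_bd: "1/4 \<le> u l" "u l = 1/4 \<or> 3/4 \<le> u l" if "l < n" for l
          using odd_quarter_bounds[OF quarter[OF u(1) that] _ bd(1)[OF that]] odd that by blast+
        have ul: "u l = 1/4" if "l < n" "l \<noteq> i" for l using odd_bd(1)[OF that(1)] bl[OF that] by simp
        have "u i \<noteq> 1/4"
        proof
          assume "u i = 1/4"
          then have "u l = 1/4" if "l < n" for l using ul that by (cases "l = i") auto
          then have "lat M u \<longleftrightarrow> lat M (\<lambda>_. 1/4)" by (intro lat_cong) (simp add: dim)
          then show False using u(1) nq by simp
        qed
        then have "u i = 3/4" using odd_bd(2)[OF i(1)] bi by simp
        then have "u l = k l" if "l < n" for l
          using ul that i(2) by (cases "l = i") (auto simp: three_quarter_coord_def)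
        then show ?thesis by blast
      qed
    qed (rule thick_te_interlace_short_irreducible[OF thick M _ u])
  qed (simp add: finite_short_coords)
  moreover have "row_comb M ` three_quarter_coord ` {..<n}
      = {(3/4) \<cdot>\<^sub>v row M i + (1/4) \<cdot>\<^sub>v rsum M ({..<n} - {i}) | i. i < n}"
    using row_comb_three_quarter_coord[OF M] by (auto simp: image_image image_iff)
  ultimately show ?thesis
    unfolding image_Un row_comb_image_short_coords[OF M] by simp
qed

section \<open>Parity of the column counts in the thick case\<close>

lemma int_of_real_diff_eq:
  assumes "real a - real b = real_of_int z"
  shows "int a - int b = z"
proof -
  have "real_of_int (int a - int b) = real_of_int z" using assms by simp
  then show ?thesis by (rule of_int_eq_iff[THEN iffD1])
qed

text \<open>Half of the sum is \<open>m + 2 * z + e\<close>, and the two counts differ by an even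
  number, so both are congruent to \<open>n div 2 + e\<close> modulo 2. The value of
  \<open>e\<close> is 0 or 1 according to whether the constant 1/4 or the vectors with an entry 3/4
  are used.\<close>

lemma parity_of_summands:
  fixes p m n :: nat
  assumes n: "n = p + m" and diff: "int p - int m = 4 * z + 2 * e"
  shows "int (p mod 2) = (int (n div 2) + e) mod 2" "int (m mod 2) = (int (n div 2) + e) mod 2"
    "n mod 4 = 2 * (n div 2 mod 2)"
proof -
  have "int n = 2 * (int m + 2 * z + e)" using assms by simp
  then have k: "int (n div 2) = int m + 2 * z + e" by (simp add: zdiv_int)
  have p: "int p = int m + 2 * (2 * z + e)" using diff by simp
  have "int (m mod 2) = int m mod 2" "int (p mod 2) = int p mod 2" by (simp_all add: zmod_int)
  moreover have "(int (n div 2) + e) mod 2 = (int m + 2 * (z + e)) mod 2" unfolding k by (simp add: algebra_simps)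
  ultimately show "int (p mod 2) = (int (n div 2) + e) mod 2" "int (m mod 2) = (int (n div 2) + e) mod 2"
    unfolding p by (simp_all only: mod_mult_self2)
  have "even n" using \<open>int n = 2 * (int m + 2 * z + e)\<close> by (metis dvd_triv_left even_of_nat)
  then obtain l where "n = 2 * l" by (rule evenE)
  then show "n mod 4 = 2 * (n div 2 mod 2)" by (simp add: mult_mod_right)
qed

text \<open>The column sum of a nonzero column is \<open>0\<close> modulo 4 in the first case and \<open>2\<close> modulo 4 in the
  second one; together with \<open>n\<close> it determines the parity of the two counts.\<close>

lemma thick_te_interlace_column_parity_quarter:
  assumes thick: "thick_te_interlace M {..<n}" and M: "M \<in> carrier_mat n d"
    and q: "lat M (\<lambda>_. 1/4)" and j: "j < d" "\<exists>i<n. M $$ (i, j) \<noteq> 0"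
  shows "card {i. i < n \<and> M $$ (i, j) = 1} mod 2 = n div 2 mod 2"
    "card {i. i < n \<and> M $$ (i, j) = -1} mod 2 = n div 2 mod 2" "n mod 4 = (2 * (n div 2 mod 2)) mod 4"
proof -
  have inter: "te_interlace M {..<n}" using thick by (simp add: thick_te_interlace_def)
  define p m where "p = card {i. i < n \<and> M $$ (i, j) = 1}" and "m = card {i. i < n \<and> M $$ (i, j) = -1}"
  note counts = te_interlace_column_counts[OF inter M j, folded p_def m_def]
  have "(\<Sum>i<n. 1/4 * M $$ (i, j)) \<in> \<int>" using q M j(1) by (simp add: lat_def)
  then obtain z where "(\<Sum>i<n. 1/4 * M $$ (i, j)) = of_int z" by (rule Ints_cases)
  then have "real p - real m = of_int (4 * z)"
    unfolding counts(1)[symmetric] sum_distrib_left[symmetric] by simp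
  then have "int p - int m = 4 * z + 2 * 0" using int_of_real_diff_eq by fastforce
  note parity = parity_of_summands[OF counts(2) this]
  have zero: "(int (n div 2) + 0) mod 2 = int (n div 2 mod 2)" by (simp add: zmod_int)
  show "p mod 2 = n div 2 mod 2" using parity(1) unfolding zero by linarith
  show "m mod 2 = n div 2 mod 2" using parity(2) unfolding zero by linarith
  show "n mod 4 = (2 * (n div 2 mod 2)) mod 4" using parity(3) by (metis mod_mod_trivial)
qed

lemma thick_te_interlace_column_parity_three_quarter:
  assumes thick: "thick_te_interlace M {..<n}" and M: "M \<in> carrier_mat n d"
    and t: "\<forall>i<n. lat M (three_quarter_coord i)" and j: "j < d" "\<exists>i<n. M $$ (i, j) \<noteq> 0"
  shows "card {i. i < n \<and> M $$ (i, j) = 1} mod 2 = (n div 2 + 1) mod 2"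
    "card {i. i < n \<and> M $$ (i, j) = -1} mod 2 = (n div 2 + 1) mod 2"
    "n mod 4 \<noteq> (2 * ((n div 2 + 1) mod 2)) mod 4"
proof -
  have inter: "te_interlace M {..<n}" using thick by (simp add: thick_te_interlace_def)
  define p m where "p = card {i. i < n \<and> M $$ (i, j) = 1}" and "m = card {i. i < n \<and> M $$ (i, j) = -1}"
  note counts = te_interlace_column_counts[OF inter M j, folded p_def m_def]
  obtain i where i: "i < n" "M $$ (i, j) = 1 \<or> M $$ (i, j) = -1"
    using j te_interlace_entry[OF inter M _ j(1)] by blast
  have "(\<Sum>k<n. three_quarter_coord i k * M $$ (k, j)) \<in> \<int>" using t i(1) M j(1) by (auto simp: lat_def)
  then obtain z where z: "(\<Sum>k<n. three_quarter_coord i k * M $$ (k, j)) = of_int z" by (rule Ints_cases)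
  have "(\<Sum>k<n. three_quarter_coord i k * M $$ (k, j))
      = (\<Sum>k<n. 1/4 * M $$ (k, j) + 1/2 * (unit_coord i k * M $$ (k, j)))"
    by (intro sum.cong) (auto simp: three_quarter_coord_def unit_coord_def)
  also have "\<dots> = 1/4 * (real p - real m) + 1/2 * M $$ (i, j)"
    unfolding sum.distrib sum_distrib_left[symmetric] counts(1) sum_unit_coord[OF i(1)] ..
  finally have eq: "real p - real m = 4 * of_int z - 2 * M $$ (i, j)" using z by simp
  \<comment> \<open>The entry at row \<open>i\<close> shifts the multiple of 4 by 2 in either
    direction; \<open>4 * z - 2\<close> is rewritten as \<open>4 * (z - 1) + 2\<close>, so both
    signs give \<open>e = 1\<close>.\<close>
  have "real p - real m = of_int (4 * (z - 1) + 2 * 1) \<or> real p - real m = of_int (4 * z + 2 * 1)"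
    using i(2) eq by auto
  then obtain z' where "int p - int m = 4 * z' + 2 * 1" using int_of_real_diff_eq by blast
  note parity = parity_of_summands[OF counts(2) this]
  have succ: "(int (n div 2) + 1) mod 2 = int ((n div 2 + 1) mod 2)" by (simp add: zmod_int add.commute)
  show "p mod 2 = (n div 2 + 1) mod 2" using parity(1) unfolding succ by linarith
  show "m mod 2 = (n div 2 + 1) mod 2" using parity(2) unfolding succ by linarith
  \<comment> \<open>Since \<open>n\<close> is even, \<open>n mod 4\<close> is twice the parity of
    \<open>n div 2\<close>, while the common parity of the counts is the opposite one.\<close>
  show "n mod 4 \<noteq> (2 * ((n div 2 + 1) mod 2)) mod 4"
    unfolding parity(3) by (cases "even (n div 2)") (auto simp: even_iff_mod_2_eq_zero odd_iff_mod_2_eq_one mod_Suc)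
qed

theorem mainTheorem17:
  fixes M :: "real mat" and n d :: nat
  assumes dims: "M \<in> carrier_mat n d"
    and brick: "te_brick M {..<n}"
  defines "A \<equiv> {row M i | i. i < n}"
    and "H \<equiv> hilbert_basis d (cone_rows M)"
    and "P \<equiv> {(1/2) \<cdot>\<^sub>v (row M i + row M j) | i j. i < j \<and> j < n}"
  shows
    "(tu_set M {..<n} \<longrightarrow> H = A) \<and>
     (te_lace M {..<n} \<longrightarrow> H = A \<union> {(1/2) \<cdot>\<^sub>v rsum M {..<n}}) \<and>
     (thin_te_interlace M {..<n} \<longrightarrow> H = A \<union> P) \<and>
     (thick_te_interlace M {..<n} \<longrightarrow>
        (\<exists>p::nat. p \<in> {0, 1} \<and>
           (\<forall>j<d. (\<exists>i<n. M $$ (i,j) \<noteq> 0) \<longrightarrow>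
               card {i. i < n \<and> M $$ (i,j) = 1} mod 2 = p \<and>
               card {i. i < n \<and> M $$ (i,j) = -1} mod 2 = p) \<and>
           (n mod 4 = (2 * p) mod 4 \<longrightarrow>
               H = A \<union> P \<union> {(1/4) \<cdot>\<^sub>v rsum M {..<n}}) \<and>
           (n mod 4 \<noteq> (2 * p) mod 4 \<longrightarrow>
               H = A \<union> P \<union> {(3/4) \<cdot>\<^sub>v row M i + (1/4) \<cdot>\<^sub>v rsum M ({..<n} - {i}) | i. i < n})))"
proof (intro conjI impI)
  show "H = A" if "tu_set M {..<n}"
    unfolding H_def A_def by (rule hilbert_basis_tu_set[OF that dims])
  show "H = A \<union> {(1/2) \<cdot>\<^sub>v rsum M {..<n}}" if "te_lace M {..<n}"
    unfolding H_def A_def by (rule hilbert_basis_te_lace[OF that dims])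
  show "H = A \<union> P" if "thin_te_interlace M {..<n}"
    unfolding H_def A_def P_def by (rule hilbert_basis_thin_te_interlace[OF that dims])
next
  assume thick: "thick_te_interlace M {..<n}"
  let ?parity = "\<lambda>p. \<forall>j<d. (\<exists>i<n. M $$ (i,j) \<noteq> 0) \<longrightarrow>
    card {i. i < n \<and> M $$ (i,j) = 1} mod 2 = p \<and> card {i. i < n \<and> M $$ (i,j) = -1} mod 2 = p"
  let ?Q = "{(1/4) \<cdot>\<^sub>v rsum M {..<n}}"
    and ?T = "{(3/4) \<cdot>\<^sub>v row M i + (1/4) \<cdot>\<^sub>v rsum M ({..<n} - {i}) | i. i < n}"
  have inter: "te_interlace M {..<n}" using thick by (simp add: thick_te_interlace_def)
  obtain j0 where "j0 < d" and j0: "\<And>i. i < n \<Longrightarrow> M $$ (i, j0) = 1 \<or> M $$ (i, j0) = -1"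
    using te_interlace_nonzero_column[OF inter dims] by metis
  have "0 < n" using thick_te_interlace_ge_3[OF thick dims] by simp
  then have nz: "\<exists>i<n. M $$ (i, j0) \<noteq> 0" using j0 by force
  show "\<exists>p::nat. p \<in> {0, 1} \<and> ?parity p \<and> (n mod 4 = (2 * p) mod 4 \<longrightarrow> H = A \<union> P \<union> ?Q) \<and>
    (n mod 4 \<noteq> (2 * p) mod 4 \<longrightarrow> H = A \<union> P \<union> ?T)"
  \<comment> \<open>The parity is computed from \<open>n\<close> alone, as that of
    \<open>n div 2\<close>, shifted by one when the constant 1/4 is not in the lattice. The relation
    of \<open>n mod 4\<close> to it still comes from a nonzero column, for which \<open>j0\<close>
    serves.\<close>
  proof (cases "lat M (\<lambda>_. 1/4)")
    case True
    note parity = thick_te_interlace_column_parity_quarter[OF thick dims True]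
    have "?parity (n div 2 mod 2)" using parity(1,2) by blast
    moreover have "H = A \<union> P \<union> ?Q"
      unfolding H_def A_def P_def by (rule hilbert_basis_thick_te_interlace_quarter[OF thick dims True])
    moreover have "n div 2 mod 2 \<in> {0, 1}" by auto
    ultimately show ?thesis
      using parity(3)[OF \<open>j0 < d\<close> nz] by (intro exI[of _ "n div 2 mod 2"] conjI) auto
  next
    case False
    then have t: "\<forall>i<n. lat M (three_quarter_coord i)"
      using thick_te_interlace_lat_cases[OF thick dims] by blast
    note parity = thick_te_interlace_column_parity_three_quarter[OF thick dims t]
    have "?parity ((n div 2 + 1) mod 2)" using parity(1,2) by blast
    moreover have "H = A \<union> P \<union> ?T"
      unfolding H_def A_def P_def
      by (rule hilbert_basis_thick_te_interlace_three_quarter[OF thick dims False t])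
    moreover have "(n div 2 + 1) mod 2 \<in> {0, 1}" by auto
    ultimately show ?thesis
      using parity(3)[OF \<open>j0 < d\<close> nz] by (intro exI[of _ "(n div 2 + 1) mod 2"] conjI) auto
  qed
qed

end
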